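(* Let $A\in\mathbb{R}\setminus\{0\}$, $B\in\mathbb{R}$, $L>0$, let $0\neq\psi\in L^2(\mathbb{R},dx)$ have support contained in $[-L,L]$, let $p_0=\frac{\pi}{AL}$ and let $q_0\in\mathbb{R}$ satisfy $|q_0p_0|<2\pi$. Suppose there is a constant $\chi>0$ with $\sum_{n\in\mathbb{Z}}|\psi(x+nq_0)|^2=\chi$ for all $x\in\mathbb{R}$. Then the sequence $\{|\widehat\psi^{A,B}_{(n,m)}\rangle\}_{n,m\in\mathbb{Z}}$, where $$|\widehat\psi^{A,B}_{(n,m)}\rangle=\widetilde\eta^{A,B}\Big(nq_0,\big(\tfrac{nq_0mp_0}{2},mp_0\big)\Big)(I\psi),$$ is a tight frame in $\mathcal{H}$ with frame constant $2L\chi$.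
   Context: $\mathcal{H}=\{f\in L^2(\mathbb{R},dx):\mathcal{F}(f)(w)=0\text{ for } w<0\}$, where $\mathcal{F}(f)(w)=\frac{1}{\sqrt{2\pi}}\int_{\mathbb{R}}f(x)e^{-iwx}dx$. $I:L^2(\mathbb{R},dx)\to\mathcal{H}$ is the unitary operator that is the inverse of $T_1=S_3\circ S_2\circ S_1$, where $S_1:\mathcal{H}\to L^2(\mathbb{R}^+,dx)$, $S_1f=\mathcal{F}(f)|_{\mathbb{R}^+}$; $S_2:L^2(\mathbb{R}^+,dx)\to L^2(\mathbb{R}^+,\frac{dx}{x})$, $(S_2f)(x)=\sqrt{x}f(x)$; $S_3:L^2(\mathbb{R}^+,\frac{dx}{x})\to L^2(\mathbb{R},dx)$, $(S_3f)(x)=f(e^{-x})$. $\eta^{A,B}$ is the representation on $L^2(\mathbb{R})$ of the Heisenberg group $H$ ($\mathbb{R}\times\mathbb{R}^2$ with product $(x_1,(y_1,z_1))(x_2,(y_2,z_2))=(x_1+x_2,(y_1+y_2+x_1z_2,z_1+z_2))$) given by $(\eta^{A,B}(c,(v_1,v_2))f)(x)=e^{i[A(v_1+xv_2)+Bv_2]}f(c+x)$, and $\widetilde\eta^{A,B}=I\circ\eta^{A,B}\circ I^{-1}$, acting on $\mathcal{H}$. A countable family $\{\phi_k\}$ in a Hilbert space is a tight frame with frame constant $K>0$ if $\sum_k|\phi_k\rangle\langle\phi_k|=K\,\mathbb{I}$, equivalently $\sum_k|\langle f|\phi_k\rangle|^2=K\|f\|^2$ for all $f$ in the space. *)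

theory Defs
  imports "HOL-Analysis.Analysis"
begin

text \<open>Elements of \<open>L\<^sup>2(\<real>, dx)\<close> are represented by square-integrable Borel functions; two functions
  denote the same element iff they agree almost everywhere.\<close>

definition L2 :: "(real \<Rightarrow> complex) set" where
  "L2 = {f. f \<in> borel_measurable lborel \<and> integrable lborel (\<lambda>x. (cmod (f x))\<^sup>2)}"

definition l2_inner :: "(real \<Rightarrow> complex) \<Rightarrow> (real \<Rightarrow> complex) \<Rightarrow> complex" where
  "l2_inner f g = (\<integral>x. cnj (f x) * g x \<partial>lborel)"

definition l2_norm :: "(real \<Rightarrow> complex) \<Rightarrow> real" where
  "l2_norm f = sqrt (\<integral>x. (cmod (f x))\<^sup>2 \<partial>lborel)"

text \<open>The Fourier integral need not converge absolutely for \<open>f\<close> in \<open>L\<^sup>2\<close>. As usual, the transform is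
  the limit in \<open>L\<^sup>2\<close> of the integrals over \<open>[-N, N]\<close> (the Plancherel extension), which is
  determined up to null sets. The squared distance is taken as an extended nonnegative integral,
  so that it is infinite, rather than 0, when the difference is not square-integrable.\<close>

definition fourier_trunc :: "(real \<Rightarrow> complex) \<Rightarrow> nat \<Rightarrow> real \<Rightarrow> complex" where
  "fourier_trunc f N w =
     complex_of_real (1 / sqrt (2 * pi)) *
     (\<integral>x\<in>{- real N..real N}. f x * exp (- \<i> * complex_of_real (w * x)) \<partial>lborel)"

definition is_fourier :: "(real \<Rightarrow> complex) \<Rightarrow> (real \<Rightarrow> complex) \<Rightarrow> bool" where
  "is_fourier f g \<longleftrightarrow> f \<in> L2 \<and> g \<in> L2 \<and>
     (\<lambda>N. \<integral>\<^sup>+w. ennreal ((cmod (g w - fourier_trunc f N w))\<^sup>2) \<partial>lborel) \<longlonglongrightarrow> 0"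

definition fourier :: "(real \<Rightarrow> complex) \<Rightarrow> real \<Rightarrow> complex" where
  "fourier f = (SOME g. is_fourier f g)"

definition hardy :: "(real \<Rightarrow> complex) set" where
  "hardy = {f \<in> L2. AE w in lborel. w < 0 \<longrightarrow> fourier f w = 0}"

text \<open>Functions on \<open>\<real>\<^sup>+\<close> are represented by their extension by 0.\<close>

definition S1 :: "(real \<Rightarrow> complex) \<Rightarrow> real \<Rightarrow> complex" where
  "S1 f = (\<lambda>x. if x > 0 then fourier f x else 0)"

definition S2 :: "(real \<Rightarrow> complex) \<Rightarrow> real \<Rightarrow> complex" where
  "S2 f = (\<lambda>x. complex_of_real (sqrt x) * f x)"

definition S3 :: "(real \<Rightarrow> complex) \<Rightarrow> real \<Rightarrow> complex" where
  "S3 f = (\<lambda>x. f (exp (- x)))"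

definition T1 :: "(real \<Rightarrow> complex) \<Rightarrow> real \<Rightarrow> complex" where
  "T1 = S3 \<circ> S2 \<circ> S1"

text \<open>The inverse of \<open>T1\<close> as a map from \<open>L2\<close> to \<open>hardy\<close>, both modulo null sets: the choice is only
  between representatives of the same element.\<close>

definition T1_inv :: "(real \<Rightarrow> complex) \<Rightarrow> real \<Rightarrow> complex" where
  "T1_inv g = (SOME f. f \<in> hardy \<and> (AE x in lborel. T1 f x = g x))"

type_synonym heisenberg = "real \<times> real \<times> real"

fun heis_mult :: "heisenberg \<Rightarrow> heisenberg \<Rightarrow> heisenberg" where
  "heis_mult (x1, y1, z1) (x2, y2, z2) = (x1 + x2, y1 + y2 + x1 * z2, z1 + z2)"

fun eta :: "real \<Rightarrow> real \<Rightarrow> heisenberg \<Rightarrow> (real \<Rightarrow> complex) \<Rightarrow> real \<Rightarrow> complex" where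
  "eta A B (c, v1, v2) f =
     (\<lambda>x. exp (\<i> * complex_of_real (A * (v1 + x * v2) + B * v2)) * f (c + x))"

lemma eta_heis_mult: "eta A B (heis_mult g h) f = eta A B g (eta A B h f)"
  by (cases g; cases h) (auto simp: fun_eq_iff exp_add[symmetric] algebra_simps)

text \<open>The conjugated representation on \<open>hardy\<close>; here \<open>T1\<close> is the inverse of \<open>T1_inv\<close>.\<close>

definition eta_hardy ::
    "real \<Rightarrow> real \<Rightarrow> heisenberg \<Rightarrow> (real \<Rightarrow> complex) \<Rightarrow> real \<Rightarrow> complex" where
  "eta_hardy A B h = T1_inv \<circ> eta A B h \<circ> T1"

definition psi_hat ::
    "real \<Rightarrow> real \<Rightarrow> real \<Rightarrow> real \<Rightarrow> (real \<Rightarrow> complex) \<Rightarrow> int \<times> int \<Rightarrow> real \<Rightarrow> complex" where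
  "psi_hat A B q0 p0 \<psi> = (\<lambda>(n, m).
     eta_hardy A B
       (of_int n * q0, (of_int n * q0 * of_int m * p0) / 2, of_int m * p0)
       (T1_inv \<psi>))"

definition tight_frame ::
    "(real \<Rightarrow> complex) set \<Rightarrow> 'i set \<Rightarrow> ('i \<Rightarrow> real \<Rightarrow> complex) \<Rightarrow> real \<Rightarrow> bool" where
  "tight_frame V J \<phi> K \<longleftrightarrow>
     countable J \<and> K > 0 \<and> (\<forall>k\<in>J. \<phi> k \<in> V) \<and>
     (\<forall>f\<in>V. ((\<lambda>k. (cmod (l2_inner f (\<phi> k)))\<^sup>2) has_sum K * (l2_norm f)\<^sup>2) J)"

end

theory Submission
  imports Defs
begin

text \<open>\<open>T1\<close> is an isometry, so the coefficients of \<open>f\<close> in \<open>hardy\<close> are \<open>\<langle>F | \<eta>(h) \<psi>\<rangle>\<close> with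
  \<open>F = T1 f\<close>. As \<open>A p0 = \<pi> / L\<close>, for fixed \<open>n\<close> they are, up to unimodular factors and conjugation,
  the Fourier coefficients of \<open>F(x) cnj (\<psi>(x + n q0))\<close>, which lives on an interval of length \<open>2 L\<close>.
  Parseval's identity sums them over \<open>m\<close>, and the hypothesis on \<open>chi\<close> sums the result over \<open>n\<close>.
  Plancherel's theorem, needed for \<open>T1\<close>, is also obtained from Parseval's identity.\<close>

section \<open>Square-integrable functions\<close>

text \<open>\<open>fourier\<close> and \<open>T1_inv\<close> are choices by \<open>SOME\<close>, so
  nothing is known about them until existence and uniqueness modulo null sets are proved. The
  Fourier arguments therefore run on the relation \<open>is_fourier\<close>, and
  \<open>T1_inv\<close> is only meaningful once the transform is known to be onto; this comes from
  the adjoint, without an inversion formula. On the frame side the obstacle is that a product of two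
  \<open>L2\<close> functions need not lie in \<open>L2\<close>, so Parseval's identity does not
  apply to \<open>F(x) cnj (\<psi>(x + n q0))\<close> for free. The hypothesis on \<open>chi\<close>
  settles this as well: its term \<open>n = 0\<close> alone gives
  \<open>cmod (\<psi> x) \<le> sqrt chi\<close> for every \<open>x\<close>. The frame constant is
  the factor \<open>2 L\<close> of the unnormalised Parseval identity times the pointwise sum
  \<open>chi\<close>. Wherever a sum over the integers is exchanged with an integral, the terms are
  nonnegative; these steps use extended nonnegative integrals, because a Bochner integral of a
  non-integrable function is 0 and would hide divergence.\<close>

lemma borel_measurable_cnj [measurable (raw)]:
  "f \<in> borel_measurable M \<Longrightarrow> (\<lambda>x. cnj (f x)) \<in> borel_measurable M"
  by (rule borel_measurable_continuous_on[OF continuous_on_cnj[OF continuous_on_id]])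

lemma L2_measurable [measurable_dest]: "f \<in> L2 \<Longrightarrow> f \<in> borel_measurable borel"
  by (simp add: L2_def)

lemma L2_integrable: "f \<in> L2 \<Longrightarrow> integrable lborel (\<lambda>x. (cmod (f x))\<^sup>2)"
  by (simp add: L2_def)

lemma L2I:
  "f \<in> borel_measurable borel \<Longrightarrow> integrable lborel (\<lambda>x. (cmod (f x))\<^sup>2) \<Longrightarrow> f \<in> L2"
  by (simp add: L2_def)

lemma L2_dominated:
  assumes "g \<in> borel_measurable borel" "f \<in> L2" "\<And>x. cmod (g x) \<le> C * cmod (f x)"
  shows "g \<in> L2"
proof (rule L2I)
  show "integrable lborel (\<lambda>x. (cmod (g x))\<^sup>2)"
  proof (rule Bochner_Integration.integrable_bound)
    show "integrable lborel (\<lambda>x. C\<^sup>2 * (cmod (f x))\<^sup>2)"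
      using L2_integrable[OF assms(2)] by simp
    show "AE x in lborel. norm ((cmod (g x))\<^sup>2) \<le> norm (C\<^sup>2 * (cmod (f x))\<^sup>2)"
      using assms(3) by (auto simp flip: power_mult_distrib intro!: power_mono)
  qed (use assms in measurable)
qed (fact assms)

lemma L2_cmult [intro]: "f \<in> L2 \<Longrightarrow> (\<lambda>x. c * f x) \<in> L2"
  by (rule L2_dominated[where C = "cmod c"]) (auto simp: norm_mult)

lemma L2_minus [intro]: "f \<in> L2 \<Longrightarrow> (\<lambda>x. - f x) \<in> L2"
  by (rule L2_dominated[where C = 1]) auto

lemma L2_cnj [intro]: "f \<in> L2 \<Longrightarrow> (\<lambda>x. cnj (f x)) \<in> L2"
  by (rule L2_dominated[where C = 1 and f = f]) auto

lemma L2_zero [intro]: "(\<lambda>x. 0) \<in> L2"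
  by (simp add: L2_def)

lemma L2_indicator [intro]:
  "f \<in> L2 \<Longrightarrow> S \<in> sets borel \<Longrightarrow> (\<lambda>x. indicator S x * f x) \<in> L2"
  by (rule L2_dominated[where C = 1]) (auto simp: indicator_def)

lemma L2_add [intro]:
  assumes "f \<in> L2" "g \<in> L2"
  shows "(\<lambda>x. f x + g x) \<in> L2"
proof (rule L2I)
  note [measurable] = L2_measurable[OF assms(1)] L2_measurable[OF assms(2)]
  show "integrable lborel (\<lambda>x. (cmod (f x + g x))\<^sup>2)"
  proof (rule Bochner_Integration.integrable_bound)
    show "integrable lborel (\<lambda>x. 2 * (cmod (f x))\<^sup>2 + 2 * (cmod (g x))\<^sup>2)"
      using assms by (simp add: L2_integrable)
    have "(cmod (a + b))\<^sup>2 \<le> 2 * (cmod a)\<^sup>2 + 2 * (cmod b)\<^sup>2" for a b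
    proof -
      have "(cmod (a + b))\<^sup>2 \<le> (cmod a + cmod b)\<^sup>2"
        by (intro power_mono norm_triangle_ineq) auto
      also have "\<dots> \<le> 2 * (cmod a)\<^sup>2 + 2 * (cmod b)\<^sup>2"
        using sum_squares_bound[of "cmod a" "cmod b"] by (simp add: power2_sum)
      finally show ?thesis .
    qed
    then show "AE x in lborel. norm ((cmod (f x + g x))\<^sup>2)
        \<le> norm (2 * (cmod (f x))\<^sup>2 + 2 * (cmod (g x))\<^sup>2)"
      by simp
  qed measurable
qed (use assms in measurable)

lemma L2_diff [intro]: "f \<in> L2 \<Longrightarrow> g \<in> L2 \<Longrightarrow> (\<lambda>x. f x - g x) \<in> L2"
  using L2_add[OF _ L2_minus, of f g] by simp

lemma L2_mult_integrable:
  assumes "f \<in> L2" "g \<in> L2"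
  shows "integrable lborel (\<lambda>x. f x * g x)"
proof (rule Bochner_Integration.integrable_bound)
  note [measurable] = L2_measurable[OF assms(1)] L2_measurable[OF assms(2)]
  show "integrable lborel (\<lambda>x. (cmod (f x))\<^sup>2 + (cmod (g x))\<^sup>2)"
    using assms by (simp add: L2_integrable)
  have "cmod (a * b) \<le> (cmod a)\<^sup>2 + (cmod b)\<^sup>2" for a b
    using sum_squares_bound[of "cmod a" "cmod b"] mult_nonneg_nonneg[OF norm_ge_zero norm_ge_zero, of a b]
    unfolding norm_mult by linarith
  then show "AE x in lborel. norm (f x * g x) \<le> norm ((cmod (f x))\<^sup>2 + (cmod (g x))\<^sup>2)"
    by simp
qed (use assms in measurable)

lemma L2_inner_integrable:
  "f \<in> L2 \<Longrightarrow> g \<in> L2 \<Longrightarrow> integrable lborel (\<lambda>x. cnj (f x) * g x)"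
  by (intro L2_mult_integrable L2_cnj)

lemma l2_norm_nonneg [simp]: "0 \<le> l2_norm f"
  by (simp add: l2_norm_def)

lemma l2_norm_sq: "(l2_norm f)\<^sup>2 = (\<integral>x. (cmod (f x))\<^sup>2 \<partial>lborel)"
  by (simp add: l2_norm_def)

lemma l2_inner_self: "l2_inner f f = complex_of_real ((l2_norm f)\<^sup>2)"
  unfolding l2_inner_def l2_norm_sq integral_complex_of_real[symmetric]
  by (intro Bochner_Integration.integral_cong) (auto simp: complex_norm_square mult.commute simp del: of_real_power)

lemma l2_inner_commute: "l2_inner g f = cnj (l2_inner f g)"
  unfolding l2_inner_def by (simp flip: Bochner_Integration.integral_cnj add: mult.commute)

lemma l2_inner_add_right:
  "f \<in> L2 \<Longrightarrow> g \<in> L2 \<Longrightarrow> h \<in> L2 \<Longrightarrow> l2_inner f (\<lambda>x. g x + h x) = l2_inner f g + l2_inner f h"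
  unfolding l2_inner_def by (simp add: distrib_left L2_inner_integrable)

lemma l2_inner_diff_right:
  "f \<in> L2 \<Longrightarrow> g \<in> L2 \<Longrightarrow> h \<in> L2 \<Longrightarrow> l2_inner f (\<lambda>x. g x - h x) = l2_inner f g - l2_inner f h"
  unfolding l2_inner_def by (simp add: right_diff_distrib L2_inner_integrable)

lemma l2_inner_diff_left:
  "f \<in> L2 \<Longrightarrow> g \<in> L2 \<Longrightarrow> h \<in> L2 \<Longrightarrow> l2_inner (\<lambda>x. f x - g x) h = l2_inner f h - l2_inner g h"
  unfolding l2_inner_def by (simp add: left_diff_distrib L2_inner_integrable)

lemma l2_inner_cmult_right: "l2_inner f (\<lambda>x. c * g x) = c * l2_inner f g"
  unfolding l2_inner_def by (simp add: mult.left_commute flip: integral_mult_right_zero)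

lemma l2_norm_add_sq:
  assumes "f \<in> L2" "g \<in> L2"
  shows "(l2_norm (\<lambda>x. f x + g x))\<^sup>2 = (l2_norm f)\<^sup>2 + 2 * Re (l2_inner f g) + (l2_norm g)\<^sup>2"
proof -
  have "(cmod (f x + g x))\<^sup>2 = (cmod (f x))\<^sup>2 + 2 * Re (cnj (f x) * g x) + (cmod (g x))\<^sup>2" for x
    unfolding cmod_power2 by (simp add: power2_eq_square algebra_simps)
  moreover have "Re (l2_inner f g) = (\<integral>x. Re (cnj (f x) * g x) \<partial>lborel)"
    unfolding l2_inner_def using L2_inner_integrable[OF assms] by (rule integral_Re[symmetric])
  ultimately show ?thesis
    unfolding l2_norm_sq using L2_inner_integrable[OF assms] assms
    by (simp add: L2_integrable integrable_Re del: times_complex.sel)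
qed

lemma l2_norm_cmult: "l2_norm (\<lambda>x. c * f x) = cmod c * l2_norm f"
  by (simp add: l2_norm_def norm_mult power_mult_distrib real_sqrt_mult)

lemma l2_norm_diff_commute: "l2_norm (\<lambda>x. f x - g x) = l2_norm (\<lambda>x. g x - f x)"
  by (simp add: l2_norm_def norm_minus_commute)

text \<open>Discriminant argument: once a phase makes the inner product real, the squared norm of
  \<open>f + t u g\<close> is bounded by a real quadratic in \<open>t\<close>, which must therefore
  be nonnegative.\<close>

lemma l2_Cauchy_Schwarz:
  assumes "f \<in> L2" "g \<in> L2"
  shows "cmod (l2_inner f g) \<le> l2_norm f * l2_norm g"
proof -
  define b where "b = cmod (l2_inner f g)"
  \<comment> \<open>The phase that rotates the inner product onto the nonnegative reals. As
    \<open>sgn 0 = 0\<close>, it may vanish, so only \<open>cmod u \<le> 1\<close> is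
    available.\<close>
  define u where "u = cnj (sgn (l2_inner f g))"
  have u: "u * l2_inner f g = complex_of_real b"
  proof (cases "l2_inner f g = 0")
    case False
    have "u * l2_inner f g = complex_of_real (b\<^sup>2) / complex_of_real b"
      unfolding u_def b_def sgn_div_norm complex_norm_square
      by (simp add: scaleR_conv_of_real field_simps)
    then show ?thesis
      using False by (simp add: b_def power2_eq_square)
  qed (simp add: b_def)
  have u1: "cmod u \<le> 1"
    by (auto simp: u_def norm_sgn)
  have quad: "0 \<le> (l2_norm f)\<^sup>2 + 2 * t * b + t\<^sup>2 * (l2_norm g)\<^sup>2" for t :: real
  proof -
    have "0 \<le> (l2_norm (\<lambda>x. f x + (complex_of_real t * u) * g x))\<^sup>2" by simp
    also have "\<dots> = (l2_norm f)\<^sup>2 + 2 * Re ((complex_of_real t * u) * l2_inner f g)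
        + (cmod (complex_of_real t * u) * l2_norm g)\<^sup>2"
      using assms by (subst l2_norm_add_sq) (auto simp: l2_inner_cmult_right l2_norm_cmult)
    also have "Re ((complex_of_real t * u) * l2_inner f g) = t * b"
      by (simp add: mult.assoc u del: times_complex.sel flip: of_real_mult)
    also have "(cmod (complex_of_real t * u) * l2_norm g)\<^sup>2 \<le> t\<^sup>2 * (l2_norm g)\<^sup>2"
      using u1 unfolding power_mult_distrib norm_mult
      by (intro mult_right_mono) (auto simp: power_le_one mult_left_le)
    finally show ?thesis by simp
  qed
  have "b\<^sup>2 \<le> (l2_norm f)\<^sup>2 * (l2_norm g)\<^sup>2"
  proof (cases "l2_norm g = 0")
    case True
    have "b = 0"
    proof (rule ccontr)
      assume "b \<noteq> 0"
      then show False
        \<comment> \<open>With no quadratic term left, this \<open>t\<close> brings the right side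
          of \<open>quad\<close> down to -1.\<close>
        using quad[of "- ((l2_norm f)\<^sup>2 + 1) / (2 * b)"] True by (simp add: field_simps)
    qed
    then show ?thesis by simp
  next
    case False
    define c where "c = (l2_norm g)\<^sup>2"
    have c: "c > 0" using False by (simp add: c_def)
    \<comment> \<open>\<open>t = - b / c\<close> is the minimiser of the quadratic.\<close>
    have "2 * (- b / c) * b + (- b / c)\<^sup>2 * c = - (b\<^sup>2 / c)"
      using c by (simp add: power2_eq_square)
    then have "b\<^sup>2 / c \<le> (l2_norm f)\<^sup>2"
      using quad[of "- b / c"] by (simp add: c_def)
    then show ?thesis
      using c by (simp add: field_simps flip: c_def)
  qed
  then show ?thesis
    unfolding b_def by (metis l2_norm_nonneg mult_nonneg_nonneg power2_le_imp_le power_mult_distrib)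
qed

lemma l2_norm_triangle:
  assumes "f \<in> L2" "g \<in> L2"
  shows "l2_norm (\<lambda>x. f x + g x) \<le> l2_norm f + l2_norm g"
proof (rule power2_le_imp_le)
  have "Re (l2_inner f g) \<le> l2_norm f * l2_norm g"
    using l2_Cauchy_Schwarz[OF assms] complex_Re_le_cmod order_trans by blast
  then show "(l2_norm (\<lambda>x. f x + g x))\<^sup>2 \<le> (l2_norm f + l2_norm g)\<^sup>2"
    unfolding l2_norm_add_sq[OF assms] by (simp add: power2_sum)
qed simp

lemma l2_norm_triangle_diff:
  assumes "f \<in> L2" "g \<in> L2" "h \<in> L2"
  shows "l2_norm (\<lambda>x. f x - h x) \<le> l2_norm (\<lambda>x. f x - g x) + l2_norm (\<lambda>x. g x - h x)"
  using l2_norm_triangle[OF L2_diff[OF assms(1,2)] L2_diff[OF assms(2,3)]] by simp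

lemma nn_integral_L2:
  "f \<in> L2 \<Longrightarrow> (\<integral>\<^sup>+x. ennreal ((cmod (f x))\<^sup>2) \<partial>lborel) = ennreal ((l2_norm f)\<^sup>2)"
  unfolding l2_norm_sq by (intro nn_integral_eq_integral L2_integrable) auto

text \<open>The way into \<open>L2\<close> when integrability is not known beforehand: finiteness of
  the extended integral yields membership and norm together, which an equation between Bochner
  integrals would not.\<close>

lemma L2_nn_integralI:
  assumes [measurable]: "f \<in> borel_measurable borel"
    and "(\<integral>\<^sup>+x. ennreal ((cmod (f x))\<^sup>2) \<partial>lborel) = ennreal r" "0 \<le> r"
  shows "f \<in> L2" "(l2_norm f)\<^sup>2 = r"
proof -
  have "integrable lborel (\<lambda>x. (cmod (f x))\<^sup>2)"
    using assms by (intro integrableI_nonneg) auto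
  then show "f \<in> L2" by (intro L2I) auto
  from nn_integral_L2[OF this] show "(l2_norm f)\<^sup>2 = r"
    using assms by simp
qed

lemma l2_norm_AE_cong:
  assumes "AE x in lborel. f x = g x" "f \<in> borel_measurable borel" "g \<in> borel_measurable borel"
  shows "l2_norm f = l2_norm g"
  unfolding l2_norm_def using assms by (auto intro!: integral_cong_AE arg_cong[of _ _ sqrt])

lemma l2_inner_AE_cong:
  assumes "AE x in lborel. f x = f' x" "AE x in lborel. g x = g' x"
    and [measurable]: "f \<in> borel_measurable borel" "f' \<in> borel_measurable borel"
      "g \<in> borel_measurable borel" "g' \<in> borel_measurable borel"
  shows "l2_inner f g = l2_inner f' g'"
  unfolding l2_inner_def using assms(1,2) by (auto intro!: integral_cong_AE)

lemma l2_norm_eq_0_iff: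
  assumes "f \<in> L2"
  shows "l2_norm f = 0 \<longleftrightarrow> (AE x in lborel. f x = 0)"
proof -
  have "l2_norm f = 0 \<longleftrightarrow> (\<integral>x. (cmod (f x))\<^sup>2 \<partial>lborel) = 0"
    by (simp add: l2_norm_def)
  also have "\<dots> \<longleftrightarrow> (AE x in lborel. f x = 0)"
    by (subst integral_nonneg_eq_0_iff_AE) (auto simp: L2_integrable assms)
  finally show ?thesis .
qed

section \<open>Limits, polarization and completeness in \<open>L2\<close>\<close>

lemma tendsto_l2_inner:
  assumes L2: "\<And>n. f n \<in> L2" "\<And>n. g n \<in> L2" "F \<in> L2" "G \<in> L2"
    and f: "(\<lambda>n::nat. l2_norm (\<lambda>x. f n x - F x)) \<longlonglongrightarrow> 0"
    and g: "(\<lambda>n. l2_norm (\<lambda>x. g n x - G x)) \<longlonglongrightarrow> 0"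
  shows "(\<lambda>n. l2_inner (f n) (g n)) \<longlonglongrightarrow> l2_inner F G"
proof (rule LIM_zero_cancel, rule Lim_null_comparison)
  let ?b = "\<lambda>n. l2_norm (\<lambda>x. f n x - F x) * l2_norm (\<lambda>x. g n x - G x)
    + l2_norm (\<lambda>x. f n x - F x) * l2_norm G + l2_norm F * l2_norm (\<lambda>x. g n x - G x)"
  show "?b \<longlonglongrightarrow> 0"
    using tendsto_add[OF tendsto_add[OF tendsto_mult[OF f g] tendsto_mult[OF f tendsto_const]]
        tendsto_mult[OF tendsto_const g], of "l2_norm G" "l2_norm F"] by simp
  show "\<forall>\<^sub>F n in sequentially. cmod (l2_inner (f n) (g n) - l2_inner F G) \<le> ?b n"
  proof (intro always_eventually allI)
    fix n
    let ?a = "\<lambda>x. f n x - F x" and ?c = "\<lambda>x. g n x - G x"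
    \<comment> \<open>Expansion around the limits; every summand contains at least one factor that
      tends to 0 in norm.\<close>
    have eq: "l2_inner (f n) (g n) - l2_inner F G = l2_inner ?a ?c + l2_inner ?a G + l2_inner F ?c"
      using L2 L2_diff by (simp add: l2_inner_diff_left l2_inner_diff_right)
    have "cmod (l2_inner ?a ?c + l2_inner ?a G + l2_inner F ?c)
        \<le> cmod (l2_inner ?a ?c) + cmod (l2_inner ?a G) + cmod (l2_inner F ?c)"
      by (meson norm_triangle_ineq norm_triangle_le add_right_mono order_trans)
    then show "cmod (l2_inner (f n) (g n) - l2_inner F G) \<le> ?b n"
      unfolding eq
      using l2_Cauchy_Schwarz[OF L2_diff[OF L2(1,3)] L2_diff[OF L2(2,4)], of n n]
        l2_Cauchy_Schwarz[OF L2_diff[OF L2(1,3)] L2(4), of n]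
        l2_Cauchy_Schwarz[OF L2(3) L2_diff[OF L2(2,4)], of n] by linarith
  qed
qed

lemma tendsto_l2_norm:
  assumes L2: "\<And>n. f n \<in> L2" "F \<in> L2"
    and f: "(\<lambda>n::nat. l2_norm (\<lambda>x. f n x - F x)) \<longlonglongrightarrow> 0"
  shows "(\<lambda>n. l2_norm (f n)) \<longlonglongrightarrow> l2_norm F"
proof -
  have "(\<lambda>n. sqrt (Re (l2_inner (f n) (f n)))) \<longlonglongrightarrow> sqrt (Re (l2_inner F F))"
    using assms by (intro tendsto_intros tendsto_l2_inner)
  then show ?thesis
    by (simp add: l2_inner_self)
qed

text \<open>Turns preservation of norms by a linear map into preservation of inner products: the
  cross term is \<open>2 Re (c \<langle>f, g\<rangle>)\<close>, and \<open>c = 1\<close>,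
  \<open>c = \<i>\<close> recover the real and imaginary parts.\<close>

lemma l2_inner_polarization:
  assumes "f \<in> L2" "g \<in> L2" "F \<in> L2" "G \<in> L2"
    and eq: "\<And>c. l2_norm (\<lambda>x. f x + c * g x) = l2_norm (\<lambda>x. F x + c * G x)"
    and "l2_norm f = l2_norm F" "l2_norm g = l2_norm G"
  shows "l2_inner f g = l2_inner F G"
proof -
  have "Re (c * l2_inner f g) = Re (c * l2_inner F G)" for c
    using arg_cong[OF eq[of c], of "\<lambda>t. t\<^sup>2"] assms(1-4,6,7) L2_cmult
    by (simp add: l2_norm_add_sq l2_inner_cmult_right l2_norm_cmult del: times_complex.sel)
  from this[of 1] this[of \<i>] show ?thesis
    by (simp add: complex_eq_iff)
qed

text \<open>Each single term is at most the whole sum \<open>C\<close>, hence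
  \<open>cmod (z k) \<le> sqrt C / 2 ^ k\<close>, and comparison with a geometric series
  applies.\<close>

lemma summable_geometric_weight:
  fixes z :: "nat \<Rightarrow> complex"
  assumes "(\<Sum>k. ennreal (4 ^ k * (cmod (z k))\<^sup>2)) \<noteq> \<infinity>"
  shows "summable z"
proof -
  define C where "C = (\<Sum>k. 4 ^ k * (cmod (z k))\<^sup>2)"
  have summ: "summable (\<lambda>k. 4 ^ k * (cmod (z k))\<^sup>2)"
    using assms by (intro summable_suminf_not_top) auto
  have bound: "cmod (z k) \<le> sqrt C * (1/2) ^ k" for k
  proof -
    have "4 ^ k * (cmod (z k))\<^sup>2 \<le> C"
      unfolding C_def using sum_le_suminf[OF summ, of "{k}"] by simp
    moreover have "(4 :: real) ^ k = (2 ^ k)\<^sup>2"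
      by (simp add: power2_eq_square flip: power_mult_distrib)
    ultimately have "(2 ^ k * cmod (z k))\<^sup>2 \<le> C"
      by (simp add: power_mult_distrib)
    then have "2 ^ k * cmod (z k) \<le> sqrt C"
      by (rule real_le_rsqrt)
    then show ?thesis by (simp add: field_simps power_divide)
  qed
  show ?thesis
    by (rule summable_comparison_test'[where g = "\<lambda>k. sqrt C * (1/2) ^ k" and N = 0])
       (use bound in \<open>auto intro!: summable_mult summable_geometric\<close>)
qed

text \<open>Along a subsequence with \<open>\<Sum>\<^sub>k 4\<^sup>k \<parallel>f\<^sub>k\<^sub>+\<^sub>1 - f\<^sub>k\<parallel>\<^sup>2 < \<infinity>\<close>, the increments are almost everywhere
  bounded by a multiple of \<open>2\<^sup>-\<^sup>k\<close>; Fatou's lemma turns the pointwise limit into an \<open>L\<^sup>2\<close> limit.\<close>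

lemma L2_complete:
  assumes L2: "\<And>n::nat. f n \<in> L2"
    and Cauchy: "\<And>e. e > 0 \<Longrightarrow> \<exists>M. \<forall>m\<ge>M. \<forall>n\<ge>M. l2_norm (\<lambda>x. f m x - f n x) < e"
  obtains g where "g \<in> L2" "(\<lambda>n. l2_norm (\<lambda>x. f n x - g x)) \<longlonglongrightarrow> 0"
proof -
  note [measurable] = L2_measurable[OF L2]
  have "\<forall>k::nat. \<exists>M. \<forall>m\<ge>M. \<forall>n\<ge>M. l2_norm (\<lambda>x. f m x - f n x) < (1/4) ^ k"
    using Cauchy by simp
  then obtain M where M: "\<And>k m n. m \<ge> M k \<Longrightarrow> n \<ge> M k \<Longrightarrow> l2_norm (\<lambda>x. f m x - f n x) < (1/4) ^ k"
    by metis
  \<comment> \<open>The maximum makes \<open>r\<close> monotone, so that both \<open>r k\<close> and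
    \<open>r (Suc k)\<close> lie beyond \<open>M k\<close>; the summand \<open>k\<close> makes
    \<open>r\<close> unbounded, as the passage to the limit in \<open>Fatou\<close>
    requires.\<close>
  define r where "r k = k + Max (M ` {..k})" for k :: nat
  have r: "r k \<ge> M k" "r k \<ge> k" "r k \<le> r (Suc k)" for k
  proof -
    show "r k \<ge> M k" unfolding r_def by (intro trans_le_add2 Max_ge) auto
    show "r k \<ge> k" unfolding r_def by simp
    have "Max (M ` {..k}) \<le> Max (M ` {..Suc k})" by (intro Max_mono) auto
    then show "r k \<le> r (Suc k)" unfolding r_def by linarith
  qed
  define d where "d k x = f (r (Suc k)) x - f (r k) x" for k x
  have dL2: "d k \<in> L2" for k
    unfolding d_def using L2 by auto
  note [measurable] = L2_measurable[OF dL2]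
  \<comment> \<open>The rate \<open>(1/4) ^ k\<close> is squared to \<open>(1/16) ^ k\<close>, which
    stays summable after multiplication by the weight \<open>4 ^ k\<close>.\<close>
  have d_norm: "(l2_norm (d k))\<^sup>2 \<le> (1/16) ^ k" for k
  proof -
    have "l2_norm (d k) \<le> (1/4) ^ k"
      unfolding d_def using M[of k "r (Suc k)" "r k"] r[of k] by linarith
    then have "(l2_norm (d k))\<^sup>2 \<le> ((1/4) ^ k)\<^sup>2" by (intro power_mono) auto
    also have "((1/4) ^ k)\<^sup>2 = ((1/4)\<^sup>2 :: real) ^ k"
      by (metis power_mult mult.commute)
    also have "\<dots> = (1/16) ^ k"
      by (simp add: power2_eq_square)
    finally show ?thesis .
  qed
  have "(\<integral>\<^sup>+x. (\<Sum>k. ennreal (4 ^ k * (cmod (d k x))\<^sup>2)) \<partial>lborel)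
      = (\<Sum>k. \<integral>\<^sup>+x. ennreal (4 ^ k * (cmod (d k x))\<^sup>2) \<partial>lborel)"
    by (intro nn_integral_suminf) measurable
  also have "\<dots> \<le> (\<Sum>k. ennreal ((1/4) ^ k))"
  proof (intro suminf_le summableI allI)
    fix k
    have "(\<integral>\<^sup>+x. ennreal (4 ^ k * (cmod (d k x))\<^sup>2) \<partial>lborel)
        = ennreal (4 ^ k) * (\<integral>\<^sup>+x. ennreal ((cmod (d k x))\<^sup>2) \<partial>lborel)"
      by (subst nn_integral_cmult[symmetric]) (auto simp: ennreal_mult)
    also have "\<dots> = ennreal (4 ^ k * (l2_norm (d k))\<^sup>2)"
      by (simp add: nn_integral_L2[OF dL2] ennreal_mult)
    also have "\<dots> \<le> ennreal (4 ^ k * (1/16) ^ k)"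
      using d_norm by (intro ennreal_leI mult_left_mono) auto
    also have "4 ^ k * (1/16) ^ k = ((1/4) ^ k :: real)"
      unfolding power_mult_distrib[symmetric] by simp
    finally show "(\<integral>\<^sup>+x. ennreal (4 ^ k * (cmod (d k x))\<^sup>2) \<partial>lborel) \<le> ennreal ((1/4) ^ k)" .
  qed
  also have "\<dots> = ennreal (\<Sum>k. (1/4) ^ k)"
    by (intro suminf_ennreal2 summable_geometric) auto
  finally have "(\<integral>\<^sup>+x. (\<Sum>k. ennreal (4 ^ k * (cmod (d k x))\<^sup>2)) \<partial>lborel) \<noteq> \<infinity>"
    by (metis ennreal_less_top infinity_ennreal_def leD)
  then have "AE x in lborel. (\<Sum>k. ennreal (4 ^ k * (cmod (d k x))\<^sup>2)) \<noteq> \<infinity>"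
    by (intro nn_integral_noteq_infinite) auto
  then have conv: "AE x in lborel. convergent (\<lambda>k. f (r k) x)"
  proof eventually_elim
    case (elim x)
    then have "summable (\<lambda>k. d k x)"
      by (rule summable_geometric_weight)
    then have "convergent (\<lambda>n. \<Sum>k<n. d k x)"
      by (simp add: summable_iff_convergent)
    then have "convergent (\<lambda>n. (f (r n) x - f (r 0) x) + f (r 0) x)"
      unfolding d_def sum_lessThan_telescope[of "\<lambda>k. f (r k) x"]
      by (intro convergent_add convergent_const)
    then show ?case by simp
  qed
  define g where "g x = lim (\<lambda>k. f (r k) x)" for x
  have [measurable]: "g \<in> borel_measurable borel"
    unfolding g_def by (rule borel_measurable_lim_metric) measurable
  have lim: "AE x in lborel. (\<lambda>k. f (r k) x) \<longlonglongrightarrow> g x"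
    using conv by eventually_elim (simp add: g_def convergent_LIMSEQ_iff)
  have Fatou: "(\<integral>\<^sup>+x. ennreal ((cmod (f n x - g x))\<^sup>2) \<partial>lborel) \<le> ennreal (e\<^sup>2)"
    if e: "e > 0" "\<And>m. m \<ge> K \<Longrightarrow> l2_norm (\<lambda>x. f n x - f m x) \<le> e" for n K e
  proof -
    have "(\<integral>\<^sup>+x. ennreal ((cmod (f n x - g x))\<^sup>2) \<partial>lborel)
        = (\<integral>\<^sup>+x. liminf (\<lambda>k. ennreal ((cmod (f n x - f (r k) x))\<^sup>2)) \<partial>lborel)"
    proof (rule nn_integral_cong_AE)
      from lim show "AE x in lborel. ennreal ((cmod (f n x - g x))\<^sup>2)
          = liminf (\<lambda>k. ennreal ((cmod (f n x - f (r k) x))\<^sup>2))"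
      proof eventually_elim
        case (elim x)
        then have "(\<lambda>k. ennreal ((cmod (f n x - f (r k) x))\<^sup>2))
            \<longlonglongrightarrow> ennreal ((cmod (f n x - g x))\<^sup>2)"
          by (intro tendsto_ennrealI tendsto_power tendsto_norm tendsto_diff tendsto_const)
        then show ?case
          by (intro lim_imp_Liminf[symmetric] sequentially_bot)
      qed
    qed
    also have "\<dots> \<le> liminf (\<lambda>k. \<integral>\<^sup>+x. ennreal ((cmod (f n x - f (r k) x))\<^sup>2) \<partial>lborel)"
      by (intro nn_integral_liminf) measurable
    also have "\<dots> \<le> ennreal (e\<^sup>2)"
    proof (rule Liminf_le)
      have "\<forall>\<^sub>F k in sequentially. k \<ge> K" by (rule eventually_ge_at_top)
      then show "\<forall>\<^sub>F k in sequentially.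
          (\<integral>\<^sup>+x. ennreal ((cmod (f n x - f (r k) x))\<^sup>2) \<partial>lborel) \<le> ennreal (e\<^sup>2)"
      proof eventually_elim
        case (elim k)
        then have "l2_norm (\<lambda>x. f n x - f (r k) x) \<le> e"
          using e(2) r(2)[of k] by simp
        then show ?case
          using nn_integral_L2[OF L2_diff[OF L2 L2]]
          by (auto intro!: ennreal_leI power_mono)
      qed
    qed simp
    finally show ?thesis .
  qed
  have diff: "(\<lambda>x. f n x - g x) \<in> L2 \<and> l2_norm (\<lambda>x. f n x - g x) \<le> e"
    if e: "e > 0" "\<And>m. m \<ge> K \<Longrightarrow> l2_norm (\<lambda>x. f n x - f m x) \<le> e" for n K e
  proof -
    \<comment> \<open>Fatou's bound shows that the extended integral is finite, so membership in
      \<open>L2\<close> follows before \<open>l2_norm\<close> is evaluated.\<close>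
    obtain s where s: "(\<integral>\<^sup>+x. ennreal ((cmod (f n x - g x))\<^sup>2) \<partial>lborel) = ennreal s" "s \<ge> 0"
      using Fatou[OF e]
      by (cases "\<integral>\<^sup>+x. ennreal ((cmod (f n x - g x))\<^sup>2) \<partial>lborel") (auto simp: top_unique)
    have "s \<le> e\<^sup>2" using Fatou[OF e] s by simp
    moreover have "(\<lambda>x. f n x - g x) \<in> L2" "(l2_norm (\<lambda>x. f n x - g x))\<^sup>2 = s"
      using L2_nn_integralI[of "\<lambda>x. f n x - g x" s] s by auto
    ultimately show ?thesis
      using e(1) by (metis less_imp_le power2_le_imp_le)
  qed
  show thesis
  proof
    obtain K where "\<forall>m\<ge>K. \<forall>n\<ge>K. l2_norm (\<lambda>x. f m x - f n x) < 1"
      using Cauchy[of 1] by auto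
    then have "(\<lambda>x. f K x - g x) \<in> L2"
      using diff[of 1 K K] by force
    from L2_diff[OF L2[of K] this] show "g \<in> L2" by simp
    show "(\<lambda>n. l2_norm (\<lambda>x. f n x - g x)) \<longlonglongrightarrow> 0"
    proof (rule LIMSEQ_I)
      fix e :: real assume "e > 0"
      then obtain K where "\<forall>m\<ge>K. \<forall>n\<ge>K. l2_norm (\<lambda>x. f m x - f n x) < e / 2"
        using Cauchy[of "e / 2"] by auto
      then have "l2_norm (\<lambda>x. f n x - g x) \<le> e / 2" if "n \<ge> K" for n
        using diff[of "e / 2" K n] \<open>e > 0\<close> that by force
      then show "\<exists>K. \<forall>n\<ge>K. norm (l2_norm (\<lambda>x. f n x - g x) - 0) < e"
        using \<open>e > 0\<close> by (intro exI[of _ K]) fastforce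
    qed
  qed
qed

section \<open>Parseval's identity\<close>

text \<open>The cut to one period turns Fourier coefficients on the circle into
  \<open>l2_inner\<close> on the line. The characters are left unnormalised, with squared norm
  \<open>2 * pi\<close>; this is the source of the factors \<open>2 * pi\<close> below.\<close>

definition circle_exp :: "int \<Rightarrow> real \<Rightarrow> complex" where
  "circle_exp m x = indicator {-pi..pi} x * cis (of_int m * x)"

lemma circle_exp_measurable [measurable]: "circle_exp m \<in> borel_measurable borel"
proof -
  have [measurable]: "(\<lambda>x. cis (of_int m * x)) \<in> borel_measurable borel"
    by (intro borel_measurable_continuous_onI continuous_intros)
  show ?thesis unfolding circle_exp_def by measurable
qed

lemma cmod_circle_exp: "cmod (circle_exp m x) = indicator {-pi..pi} x"
  by (simp add: circle_exp_def norm_mult indicator_def)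

lemma circle_exp_L2 [intro, simp]: "circle_exp m \<in> L2"
proof (rule L2I)
  have "(\<lambda>x. (cmod (circle_exp m x))\<^sup>2) = indicator {-pi..pi}"
    by (auto simp: cmod_circle_exp indicator_def)
  then show "integrable lborel (\<lambda>x. (cmod (circle_exp m x))\<^sup>2)"
    by simp
qed measurable

text \<open>For distinct indices the antiderivative \<open>cis (k * x) / (\<i> * k)\<close> takes
  the same value at \<open>pi\<close> and \<open>-pi\<close>, as \<open>k\<close> is an
  integer.\<close>

lemma l2_inner_circle_exp: "l2_inner (circle_exp m) (circle_exp n) = (if m = n then complex_of_real (2 * pi) else 0)"
proof -
  have eq: "l2_inner (circle_exp m) (circle_exp n)
      = (\<integral>x. indicator {-pi..pi} x *\<^sub>R cis (of_int (n - m) * x) \<partial>lborel)"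
    unfolding l2_inner_def circle_exp_def
    by (intro Bochner_Integration.integral_cong)
       (auto simp: indicator_def cis_cnj cis_mult algebra_simps)
  show ?thesis
  proof (cases "m = n")
    case True
    then show ?thesis unfolding eq by (simp add: scaleR_conv_of_real)
  next
    case False
    define k :: real where "k = of_int (n - m)"
    have k: "k \<noteq> 0" using False by (simp add: k_def)
    have "(\<integral>x. indicator {-pi..pi} x *\<^sub>R cis (k * x) \<partial>lborel)
        = cis (k * pi) / (\<i> * of_real k) - cis (k * (-pi)) / (\<i> * of_real k)"
    proof (rule integral_FTC_Icc)
      show "((\<lambda>x. cis (k * x) / (\<i> * of_real k)) has_vector_derivative cis (k * x))
          (at x within {-pi..pi})" for x
        using k unfolding cis_conv_exp
        by (auto intro!: derivative_eq_intros has_vector_derivative_real_field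
             simp: scaleR_conv_of_real field_simps)
    qed (auto intro!: continuous_intros)
    also have "cis (k * pi) = cis (k * (-pi))"
    proof -
      have "cis (k * pi) = cis (k * (-pi)) * cis (2 * pi * k)"
        by (simp add: cis_mult algebra_simps)
      also have "cis (2 * pi * k) = 1"
        by (rule cis_multiple_2pi) (simp add: k_def)
      finally show ?thesis by simp
    qed
    finally show ?thesis using False unfolding eq k_def[symmetric] by simp
  qed
qed

lemma L2_sum [intro]: "(\<And>i. i \<in> S \<Longrightarrow> f i \<in> L2) \<Longrightarrow> (\<lambda>x. \<Sum>i\<in>S. f i x) \<in> L2"
  by (induction S rule: infinite_finite_induct) (auto intro!: L2_add L2_zero)

lemma l2_inner_sum_right:
  "f \<in> L2 \<Longrightarrow> (\<And>i. i \<in> S \<Longrightarrow> g i \<in> L2) \<Longrightarrow>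
    l2_inner f (\<lambda>x. \<Sum>i\<in>S. g i x) = (\<Sum>i\<in>S. l2_inner f (g i))"
proof (induction S rule: infinite_finite_induct)
  case (insert i S)
  then show ?case
    by (simp add: l2_inner_add_right L2_sum)
qed (auto simp: l2_inner_def)

lemma l2_norm_diff_sq:
  assumes "f \<in> L2" "g \<in> L2"
  shows "(l2_norm (\<lambda>x. f x - g x))\<^sup>2 = (l2_norm f)\<^sup>2 - 2 * Re (l2_inner f g) + (l2_norm g)\<^sup>2"
  using l2_norm_add_sq[OF assms(1) L2_cmult[OF assms(2), of "-1"]]
  unfolding l2_inner_cmult_right l2_norm_cmult by simp

text \<open>Completing the square in the coefficients. One identity serves twice: the optimal
  \<open>p\<close> kills the last sum and gives Bessel's inequality, while dropping that sum bounds
  the Bessel defect by any approximation error. The conjugate appears because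
  \<open>l2_inner\<close> is antilinear in its first argument.\<close>

lemma l2_norm_diff_trig:
  fixes p :: "int \<Rightarrow> complex"
  assumes G: "G \<in> L2" and S: "finite S"
  shows "(l2_norm (\<lambda>x. G x - (\<Sum>m\<in>S. p m * circle_exp m x)))\<^sup>2
    = (l2_norm G)\<^sup>2 - (\<Sum>m\<in>S. (cmod (l2_inner G (circle_exp m)))\<^sup>2) / (2 * pi)
      + 2 * pi * (\<Sum>m\<in>S. (cmod (p m - cnj (l2_inner G (circle_exp m)) / (2 * pi)))\<^sup>2)"
proof -
  let ?c = "\<lambda>m. l2_inner G (circle_exp m)"
  let ?P = "\<lambda>x. \<Sum>m\<in>S. p m * circle_exp m x"
  have P: "?P \<in> L2" by (intro L2_sum L2_cmult) auto
  have GP: "l2_inner G ?P = (\<Sum>m\<in>S. p m * ?c m)"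
    using G by (subst l2_inner_sum_right) (auto simp: l2_inner_cmult_right)
  have fP: "l2_inner (circle_exp m) ?P = (if m \<in> S then p m * (2 * pi) else 0)" for m
    using S by (subst l2_inner_sum_right)
      (auto simp: l2_inner_cmult_right l2_inner_circle_exp if_distrib[of "\<lambda>x. _ * x"] cong: if_cong)
  have "complex_of_real ((l2_norm ?P)\<^sup>2) = (\<Sum>m\<in>S. p m * cnj (l2_inner (circle_exp m) ?P))"
    unfolding l2_inner_self[symmetric] l2_inner_commute[of _ "circle_exp _", symmetric]
    by (subst l2_inner_sum_right[OF P]) (auto simp: l2_inner_cmult_right simp flip: l2_inner_commute)
  also have "\<dots> = complex_of_real (\<Sum>m\<in>S. 2 * pi * (cmod (p m))\<^sup>2)"
    unfolding of_real_sum
    by (intro sum.cong) (auto simp: fP complex_norm_square simp del: of_real_power)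
  finally have PP: "(l2_norm ?P)\<^sup>2 = (\<Sum>m\<in>S. 2 * pi * (cmod (p m))\<^sup>2)"
    unfolding of_real_eq_iff .
  have "(l2_norm (\<lambda>x. G x - ?P x))\<^sup>2 = (l2_norm G)\<^sup>2 - 2 * Re (l2_inner G ?P) + (l2_norm ?P)\<^sup>2"
    by (rule l2_norm_diff_sq[OF G P])
  also have "\<dots> = (l2_norm G)\<^sup>2 + (\<Sum>m\<in>S. 2 * pi * (cmod (p m))\<^sup>2 - 2 * Re (p m * ?c m))"
    by (simp add: GP PP sum_subtractf sum_distrib_left del: times_complex.sel)
  also have "(\<Sum>m\<in>S. 2 * pi * (cmod (p m))\<^sup>2 - 2 * Re (p m * ?c m))
      = (\<Sum>m\<in>S. 2 * pi * (cmod (p m - cnj (?c m) / (2 * pi)))\<^sup>2 - (cmod (?c m))\<^sup>2 / (2 * pi))"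
  proof (intro sum.cong refl)
    fix m
    have "2 * pi * (cmod (a - cnj b / (2 * pi)))\<^sup>2 - (cmod b)\<^sup>2 / (2 * pi)
        = 2 * pi * (cmod a)\<^sup>2 - 2 * Re (a * b)" for a b
      unfolding cmod_power2 by (simp add: field_simps power2_eq_square)
    from this[of "p m" "?c m"]
    show "2 * pi * (cmod (p m))\<^sup>2 - 2 * Re (p m * ?c m)
      = 2 * pi * (cmod (p m - cnj (?c m) / (2 * pi)))\<^sup>2 - (cmod (?c m))\<^sup>2 / (2 * pi)"
      by simp
  qed
  finally show ?thesis
    by (simp add: sum_subtractf sum_distrib_left sum_divide_distrib)
qed

section \<open>Trigonometric polynomials\<close>

text \<open>Closure rules instead of finite coefficient families, so that products need no index
  bookkeeping; \<open>trig_poly_imp_sum\<close> recovers the family at the end.\<close>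

inductive trig_poly :: "(real \<Rightarrow> complex) \<Rightarrow> bool" where
  monom: "trig_poly (\<lambda>x. c * cis (of_int m * x))"
| add: "trig_poly f \<Longrightarrow> trig_poly g \<Longrightarrow> trig_poly (\<lambda>x. f x + g x)"

lemma trig_poly_const: "trig_poly (\<lambda>x. c)"
  using monom[of c 0] by simp

lemma trig_poly_mult_monom:
  assumes "trig_poly f"
  shows "trig_poly (\<lambda>x. c * cis (of_int m * x) * f x)"
  using assms
proof induction
  case (monom d n)
  have "(\<lambda>x. c * cis (of_int m * x) * (d * cis (of_int n * x)))
      = (\<lambda>x. (c * d) * cis (of_int (m + n) * x))"
    by (auto simp: cis_mult[symmetric] distrib_right)
  then show ?case using trig_poly.monom[of "c * d" "m + n"] by simp
next
  case (add f g)
  then show ?case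
    using trig_poly.add by (simp add: distrib_left)
qed

lemma trig_poly_mult:
  assumes "trig_poly f" "trig_poly g"
  shows "trig_poly (\<lambda>x. f x * g x)"
  using assms(1)
proof induction
  case (monom c m)
  then show ?case using trig_poly_mult_monom[OF assms(2)] by simp
next
  case (add f h)
  then show ?case
    using trig_poly.add by (simp add: distrib_right)
qed

lemma trig_poly_cos: "trig_poly (\<lambda>x. of_real (cos x))"
proof -
  have "(\<lambda>x. complex_of_real (cos x))
      = (\<lambda>x. 1/2 * cis (of_int 1 * x) + 1/2 * cis (of_int (-1) * x))"
    by (auto simp: complex_eq_iff)
  then show ?thesis
    using trig_poly.add[OF trig_poly.monom[of "1/2" 1] trig_poly.monom[of "1/2" "-1"]] by simp
qed

lemma trig_poly_sin: "trig_poly (\<lambda>x. of_real (sin x))"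
proof -
  have "(\<lambda>x. complex_of_real (sin x))
      = (\<lambda>x. (- \<i> / 2) * cis (of_int 1 * x) + (\<i> / 2) * cis (of_int (-1) * x))"
    by (auto simp: complex_eq_iff)
  then show ?thesis
    using trig_poly.add[OF trig_poly.monom[of "- \<i> / 2" 1] trig_poly.monom[of "\<i> / 2" "-1"]] by simp
qed

lemma trig_poly_real_polynomial:
  fixes p :: "complex \<Rightarrow> real"
  assumes "real_polynomial_function p"
  shows "trig_poly (\<lambda>x. of_real (p (cis x)))"
  using assms
proof induction
  case (linear f)
  interpret bounded_linear f by fact
  \<comment> \<open>The base case of \<open>real_polynomial_function\<close> consists of real-linear
    functionals, determined on the plane by their values at 1 and \<open>\<i>\<close>.\<close>
  have "f (cis x) = cos x * f 1 + sin x * f \<i>" for x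
  proof -
    have "cis x = cos x *\<^sub>R 1 + sin x *\<^sub>R \<i>" by (simp add: complex_eq_iff)
    then have "f (cis x) = f (cos x *\<^sub>R 1 + sin x *\<^sub>R \<i>)" by (rule arg_cong)
    then show ?thesis by (simp only: add scaleR real_scaleR_def)
  qed
  then show ?case
    using trig_poly.add[OF trig_poly_mult[OF trig_poly_cos trig_poly_const[of "of_real (f 1)"]]
        trig_poly_mult[OF trig_poly_sin trig_poly_const[of "of_real (f \<i>)"]]]
    by simp
qed (auto intro: trig_poly_const trig_poly.add trig_poly_mult)

lemma trig_poly_imp_sum:
  assumes "trig_poly f"
  shows "\<exists>S p. finite S \<and> (\<forall>x. indicator {-pi..pi} x * f x = (\<Sum>m\<in>S. p m * circle_exp m x))"
  using assms
proof induction
  case (monom c m)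
  show ?case
    by (rule exI[of _ "{m}"], rule exI[of _ "\<lambda>_. c"]) (auto simp: circle_exp_def)
next
  case (add f g)
  obtain S p where S: "finite S" "\<And>x. indicator {-pi..pi} x * f x = (\<Sum>m\<in>S. p m * circle_exp m x)"
    using add.IH(1) by blast
  obtain T q where T: "finite T" "\<And>x. indicator {-pi..pi} x * g x = (\<Sum>m\<in>T. q m * circle_exp m x)"
    using add.IH(2) by blast
  \<comment> \<open>Both coefficient families are extended by 0 to the common index set; on the
    overlap they add up.\<close>
  let ?p = "\<lambda>m. (if m \<in> S then p m else 0) + (if m \<in> T then q m else 0)"
  show ?case
  proof (intro exI[of _ "S \<union> T"] exI[of _ ?p] conjI allI)
    show "finite (S \<union> T)" using S T by simp
    fix x
    have "(\<Sum>m\<in>S. p m * circle_exp m x) = (\<Sum>m\<in>S\<union>T. (if m \<in> S then p m else 0) * circle_exp m x)"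
      by (rule sum.mono_neutral_cong_left) (use S T in auto)
    moreover have "(\<Sum>m\<in>T. q m * circle_exp m x) = (\<Sum>m\<in>S\<union>T. (if m \<in> T then q m else 0) * circle_exp m x)"
      by (rule sum.mono_neutral_cong_left) (use S T in auto)
    ultimately show "indicator {-pi..pi} x * (f x + g x) = (\<Sum>m\<in>S\<union>T. ?p m * circle_exp m x)"
      unfolding distrib_left S(2) T(2) by (simp add: sum.distrib distrib_right)
  qed
qed

text \<open>Stone-Weierstrass on the unit circle, with polynomials in the real and imaginary parts;
  pulled back along \<open>cis\<close>, these are trigonometric polynomials.\<close>

lemma trig_poly_approx:
  fixes \<phi> :: "complex \<Rightarrow> complex"
  assumes "continuous_on (sphere 0 1) \<phi>" "e > 0"
  obtains t where "trig_poly t" "\<And>x. cmod (\<phi> (cis x) - t x) < e"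
proof -
  obtain g where g: "polynomial_function g" "\<And>z. z \<in> sphere 0 1 \<Longrightarrow> cmod (\<phi> z - g z) < e"
    using Stone_Weierstrass_polynomial_function[OF compact_sphere assms] by blast
  have "real_polynomial_function (Re \<circ> g)" "real_polynomial_function (Im \<circ> g)"
    using g(1) bounded_linear_Re bounded_linear_Im unfolding polynomial_function_def by auto
  from this[THEN trig_poly_real_polynomial]
  have "trig_poly (\<lambda>x. of_real (Re (g (cis x))) + \<i> * of_real (Im (g (cis x))))"
    by (intro trig_poly.add trig_poly_mult trig_poly_const) auto
  then have "trig_poly (\<lambda>x. g (cis x))"
    by (simp add: complex_eq[symmetric])
  then show thesis
    using that g(2) by auto
qed

section \<open>Density of trigonometric polynomials in \<open>L2\<close> of an interval\<close>

lemma tendsto_l2_norm_dominated: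
  assumes [measurable]: "\<And>n::nat. f n \<in> borel_measurable borel" "F \<in> borel_measurable borel"
    and lim: "AE x in lborel. (\<lambda>n. f n x) \<longlonglongrightarrow> F x"
    and w: "integrable lborel (\<lambda>x. (w x)\<^sup>2)"
    and bound: "\<And>n. AE x in lborel. cmod (f n x - F x) \<le> w x"
  shows "(\<lambda>n. l2_norm (\<lambda>x. f n x - F x)) \<longlonglongrightarrow> 0"
proof -
  have "(\<lambda>n. \<integral>x. (cmod (f n x - F x))\<^sup>2 \<partial>lborel) \<longlonglongrightarrow> (\<integral>x. 0 \<partial>(lborel :: real measure))"
  proof (rule integral_dominated_convergence[OF _ _ w])
    show "AE x in lborel. (\<lambda>n. (cmod (f n x - F x))\<^sup>2) \<longlonglongrightarrow> 0"
      using lim by eventually_elim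
        (auto intro!: tendsto_eq_intros tendsto_norm_zero dest: LIM_zero)
    show "AE x in lborel. norm ((cmod (f n x - F x))\<^sup>2) \<le> (w x)\<^sup>2" for n
      using bound[of n] by eventually_elim (auto intro!: power_mono)
  qed measurable
  then show ?thesis
    unfolding l2_norm_def by (auto intro!: tendsto_eq_intros)
qed

text \<open>\<open>measurable_on\<close> is defined by pointwise limits of continuous functions off
  a negligible set; the detour through \<open>lebesgue\<close> makes that characterisation
  available.\<close>

lemma borel_approx_continuous:
  fixes f :: "real \<Rightarrow> complex"
  assumes "f \<in> borel_measurable borel"
  obtains g where "\<And>n::nat. continuous_on UNIV (g n)"
    "AE x in lborel. (\<lambda>n. g n x) \<longlonglongrightarrow> f x"
proof -
  have "f \<in> borel_measurable lebesgue"
    using assms by (simp add: measurable_completion)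
  then have "f measurable_on UNIV"
    by (rule lebesgue_measurable_imp_measurable_on) simp
  then obtain N g where N: "negligible N" and g: "\<And>n. continuous_on UNIV (g n)"
    "\<And>x. x \<notin> N \<Longrightarrow> (\<lambda>n. g n x) \<longlonglongrightarrow> f x"
    unfolding measurable_on_def by auto
  from N have "AE x in lebesgue. x \<notin> N"
    by (intro AE_not_in) (simp add: negligible_iff_null_sets)
  then have "AE x in lborel. x \<notin> N"
    by (simp add: AE_completion_iff)
  then have "AE x in lborel. (\<lambda>n. g n x) \<longlonglongrightarrow> f x"
    by eventually_elim (rule g(2))
  with g(1) show thesis by (rule that)
qed

text \<open>Radial retraction of the plane onto the closed disc of radius \<open>Suc k\<close>. The
  successor keeps the denominator positive for \<open>k = 0\<close>.\<close>

definition clamp_norm :: "nat \<Rightarrow> complex \<Rightarrow> complex" where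
  "clamp_norm k z = z * of_real (real (Suc k) / max (real (Suc k)) (cmod z))"

lemma continuous_on_clamp_norm: "continuous_on S (clamp_norm k)"
  unfolding clamp_norm_def
  by (intro continuous_intros) (auto simp: max_def)

lemma clamp_norm_measurable [measurable]: "clamp_norm k \<in> borel_measurable borel"
  by (intro borel_measurable_continuous_onI continuous_on_clamp_norm)

lemma cmod_clamp_norm_le: "cmod (clamp_norm k z) \<le> real (Suc k)"
proof -
  have "cmod (clamp_norm k z) = real (Suc k) * (cmod z / max (real (Suc k)) (cmod z))"
    by (simp add: clamp_norm_def norm_mult norm_divide del: of_nat_Suc)
  also have "\<dots> \<le> real (Suc k) * 1"
    by (intro mult_left_mono) (auto simp: divide_simps max_def)
  finally show ?thesis by simp
qed

lemma clamp_norm_eq: "cmod z \<le> real (Suc k) \<Longrightarrow> clamp_norm k z = z"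
  by (simp add: clamp_norm_def max_def)

lemma cmod_clamp_norm_diff_le: "cmod (clamp_norm k z - z) \<le> cmod z"
proof -
  define t where "t = real (Suc k) / max (real (Suc k)) (cmod z)"
  have t: "0 \<le> t" "t \<le> 1" by (auto simp: t_def divide_simps max_def)
  have "clamp_norm k z - z = z * of_real (t - 1)"
    by (simp add: clamp_norm_def t_def algebra_simps)
  then have "cmod (clamp_norm k z - z) = cmod z * \<bar>t - 1\<bar>"
    by (simp only: norm_mult norm_of_real)
  also have "\<dots> \<le> cmod z * 1" using t by (intro mult_left_mono) auto
  finally show ?thesis by simp
qed

text \<open>The cutoff vanishes at \<open>-1\<close>, which compensates the jump of \<open>Arg\<close> there.\<close>

lemma continuous_on_circle_cutoff:
  fixes q :: "real \<Rightarrow> complex"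
  assumes q: "continuous_on UNIV q" and bound: "\<And>x. cmod (q x) \<le> C"
  shows "continuous_on (sphere 0 1) (\<lambda>z. of_real (min 1 (real n * (1 + Re z))) * q (Arg z))"
proof -
  have "continuous (at z within sphere 0 1) (\<lambda>z. of_real (min 1 (real n * (1 + Re z))) * q (Arg z))"
    if z: "z \<in> sphere 0 1" for z
  proof (cases "z = -1")
    case True
    have "((\<lambda>z. complex_of_real (min 1 (real n * (1 + Re z)))) \<longlongrightarrow> 0) (at (-1) within sphere 0 1)"
      by (rule tendsto_eq_intros refl | simp)+
    \<comment> \<open>\<open>q (Arg z)\<close> may jump at \<open>-1\<close>, but a bounded factor
      times one that tends to 0 tends to 0, which is also the value there.\<close>
    moreover have "Bfun (\<lambda>z. q (Arg z)) (at (-1) within sphere 0 1)"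
      using bound by (intro BfunI[of _ C]) auto
    ultimately show ?thesis
      unfolding True continuous_within
      using bounded_bilinear.Zfun_prod_Bfun[OF bounded_bilinear_mult] 
      by (simp add: tendsto_Zfun_iff)
  next
    case False
    have "z \<notin> \<real>\<^sub>\<le>\<^sub>0"
    proof
      assume "z \<in> \<real>\<^sub>\<le>\<^sub>0"
      then have "Im z = 0" "Re z \<le> 0" by (auto simp: complex_nonpos_Reals_iff)
      with z False show False by (auto simp: complex_eq_iff cmod_def)
    qed
    then have "continuous (at z within sphere 0 1) Arg"
      by (rule continuous_within_Arg)
    moreover have "isCont q (Arg z)"
      using q by (simp add: continuous_on_eq_continuous_at)
    ultimately have "continuous (at z within sphere 0 1) (\<lambda>z. q (Arg z))"
      unfolding continuous_within[of z _ Arg] continuous_within[of z _ "\<lambda>z. q (Arg z)"]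
      by (intro isCont_tendsto_compose[of _ q])
    then show ?thesis
      unfolding continuous_within by (intro tendsto_intros)
  qed
  then show ?thesis
    by (simp add: continuous_on_eq_continuous_within)
qed

text \<open>Clamping supplies the dominating function that turns almost everywhere convergence of
  continuous approximants into \<open>L2\<close> convergence; the cutoff makes them continuous on
  the circle, where uniform approximation is at hand. Each of the three errors is kept below
  \<open>e / 3\<close>.\<close>

lemma trig_dense:
  assumes G: "G \<in> L2" and supp: "\<And>x. x \<notin> {-pi..pi} \<Longrightarrow> G x = 0" and e: "e > 0"
  obtains S p where "finite S" "l2_norm (\<lambda>x. G x - (\<Sum>m\<in>S. p m * circle_exp m x)) < e"
proof -
  note [measurable] = L2_measurable[OF G]
  have "(\<lambda>k. l2_norm (\<lambda>x. clamp_norm k (G x) - G x)) \<longlonglongrightarrow> 0"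
  proof (rule tendsto_l2_norm_dominated[where w = "\<lambda>x. cmod (G x)"])
    show "AE x in lborel. (\<lambda>k. clamp_norm k (G x)) \<longlonglongrightarrow> G x"
    proof (intro AE_I2 tendsto_eventually)
      fix x
      show "\<forall>\<^sub>F k in sequentially. clamp_norm k (G x) = G x"
        using eventually_ge_at_top[of "nat \<lceil>cmod (G x)\<rceil>"]
      proof eventually_elim
        case (elim k)
        then have "cmod (G x) \<le> real (Suc k)" by linarith
        then show ?case by (rule clamp_norm_eq)
      qed
    qed
  qed (use L2_integrable[OF G] cmod_clamp_norm_diff_le in auto)
  from LIMSEQ_D[OF this, of "e / 3"] e obtain k
    where "l2_norm (\<lambda>x. clamp_norm k (G x) - G x) < e / 3" by auto
  then have k: "l2_norm (\<lambda>x. G x - clamp_norm k (G x)) < e / 3"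
    by (subst l2_norm_diff_commute)
  define C where "C = real (Suc k)"
  have C: "C > 0" "\<And>z. cmod (clamp_norm k z) \<le> C"
    unfolding C_def by (simp, rule cmod_clamp_norm_le)
  have clampL2: "(\<lambda>x. clamp_norm k (G x)) \<in> L2"
    by (rule L2_dominated[OF _ G, of _ 2])
       (measurable, use cmod_clamp_norm_diff_le norm_triangle_sub[of "clamp_norm k (G _)"] in
         \<open>smt (verit, ccfv_SIG)\<close>)
  obtain g where g: "\<And>n::nat. continuous_on UNIV (g n)"
      "AE x in lborel. (\<lambda>n. g n x) \<longlonglongrightarrow> G x"
    using borel_approx_continuous[of G] by auto
  \<comment> \<open>The approximants themselves are clamped: they become uniformly bounded by
    \<open>C\<close> and, by continuity of \<open>clamp_norm\<close>, still converge to the clamped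
    \<open>G\<close>.\<close>
  define q where "q n x = clamp_norm k (g n x)" for n x
  have qc: "continuous_on UNIV (q n)" for n
    unfolding q_def using continuous_on_compose2[OF continuous_on_clamp_norm g(1)] by auto
  have qb: "cmod (q n x) \<le> C" for n x
    unfolding q_def by (rule C)
  note [measurable] = borel_measurable_continuous_onI[OF qc]
  \<comment> \<open>The cutoff of \<open>continuous_on_circle_cutoff\<close> at
    \<open>cis x\<close>: it is 0 at \<open>-pi\<close> and \<open>pi\<close>, and for every
    \<open>x\<close> strictly between it equals 1 for large \<open>n\<close>.\<close>
  define b where "b n x = min 1 (real n * (1 + cos x))" for n x
  have b: "0 \<le> b n x" "b n x \<le> 1" for n x
  proof -
    have "0 \<le> 1 + cos x" using cos_ge_minus_one[of x] by linarith
    then show "0 \<le> b n x" "b n x \<le> 1" unfolding b_def by auto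
  qed
  have [measurable]: "b n \<in> borel_measurable borel" for n
    unfolding b_def by (intro borel_measurable_continuous_onI continuous_intros)
  define h where "h n x = indicator {-pi..pi} x * (of_real (b n x) * q n x)" for n x
  have [measurable]: "h n \<in> borel_measurable borel" for n
    unfolding h_def by measurable
  have ind: "integrable lborel (\<lambda>x. (c * indicator {-pi..pi} x)\<^sup>2)" for c :: real
  proof -
    have "(\<lambda>x. (c * indicator {-pi..pi} x)\<^sup>2) = (\<lambda>x. c\<^sup>2 * indicator {-pi..pi} x)"
      by (auto simp: indicator_def)
    then show ?thesis by simp
  qed
  have hb: "cmod (h n x) \<le> C * indicator {-pi..pi} x" for n x
    using mult_mono[OF b(2) qb, of n x n x] b C
    by (auto simp: h_def norm_mult indicator_def)
  have hL2: "h n \<in> L2" for n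
  proof (rule L2I)
    show "integrable lborel (\<lambda>x. (cmod (h n x))\<^sup>2)"
      by (rule Bochner_Integration.integrable_bound[OF ind[of C]])
         (use hb in \<open>auto intro!: power_mono simp del: power_mult_distrib\<close>)
  qed measurable
  have "(\<lambda>n. l2_norm (\<lambda>x. h n x - clamp_norm k (G x))) \<longlonglongrightarrow> 0"
  proof (rule tendsto_l2_norm_dominated[where w = "\<lambda>x. 2 * C * indicator {-pi..pi} x"])
    \<comment> \<open>At the endpoints the cutoff is 0 for every \<open>n\<close>, so convergence is
      claimed only off this null set.\<close>
    have "AE x in lborel. x \<noteq> pi \<and> x \<noteq> -pi"
      by (intro AE_conjI AE_lborel_singleton)
    with g(2) show "AE x in lborel. (\<lambda>n. h n x) \<longlonglongrightarrow> clamp_norm k (G x)"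
    proof eventually_elim
      case (elim x)
      show ?case
      proof (cases "x \<in> {-pi..pi}")
        case True
        then have x: "-pi < x" "x < pi" using elim by auto
        have "cos x \<noteq> -1"
        proof
          assume "cos x = -1"
          then have "\<bar>x\<bar> = pi" using x by - (rule cos_inj_pi, auto)
          then show False using x by linarith
        qed
        then have pos: "1 + cos x > 0" using cos_ge_minus_one[of x] by linarith
        have "\<forall>\<^sub>F n in sequentially. b n x = 1"
          using eventually_ge_at_top[of "nat \<lceil>1 / (1 + cos x)\<rceil>"]
        proof eventually_elim
          case (elim n)
          then have "1 / (1 + cos x) \<le> real n" by linarith
          then show ?case using pos by (simp add: b_def field_simps min_def)
        qed
        then have "(\<lambda>n. b n x) \<longlonglongrightarrow> 1" by (rule tendsto_eventually)
        moreover have "(\<lambda>n. q n x) \<longlonglongrightarrow> clamp_norm k (G x)"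
          unfolding q_def using elim continuous_on_clamp_norm[of UNIV k]
          by (auto intro!: isCont_tendsto_compose[of _ "clamp_norm k"] simp: continuous_on_eq_continuous_at)
        ultimately have "(\<lambda>n. of_real (b n x) * q n x) \<longlonglongrightarrow> of_real 1 * clamp_norm k (G x)"
          by (intro tendsto_mult tendsto_of_real)
        then show ?thesis using True by (simp add: h_def)
      qed (simp add: h_def supp clamp_norm_eq)
    qed
    have "cmod (h n x - clamp_norm k (G x)) \<le> 2 * C * indicator {-pi..pi} x" for n x
    proof (cases "x \<in> {-pi..pi}")
      case True
      then show ?thesis
        using norm_triangle_ineq4[of "h n x" "clamp_norm k (G x)"] hb[of n x] C(2)[of "G x"] by simp
    qed (simp add: h_def supp clamp_norm_eq)
    then show "AE x in lborel. cmod (h n x - clamp_norm k (G x)) \<le> 2 * C * indicator {-pi..pi} x" for n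
      by simp
  qed (use ind in measurable)
  from LIMSEQ_D[OF this, of "e / 3"] e obtain n
    where "l2_norm (\<lambda>x. h n x - clamp_norm k (G x)) < e / 3" by auto
  then have n: "l2_norm (\<lambda>x. clamp_norm k (G x) - h n x) < e / 3"
    by (subst l2_norm_diff_commute)
  \<comment> \<open>A uniform error \<open>d\<close> on an interval of length \<open>2 * pi\<close>
    has \<open>L2\<close> size at most \<open>d * sqrt (2 * pi) = e / 6\<close>.\<close>
  define d where "d = e / (6 * sqrt (2 * pi))"
  have d: "d > 0" using e by (simp add: d_def)
  obtain t where t: "trig_poly t"
      "\<And>x. cmod (of_real (min 1 (real n * (1 + Re (cis x)))) * q n (Arg (cis x)) - t x) < d"
    using trig_poly_approx[OF continuous_on_circle_cutoff[OF qc qb] d] by blast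
  obtain S p where S: "finite S" "\<And>x. indicator {-pi..pi} x * t x = (\<Sum>m\<in>S. p m * circle_exp m x)"
    using trig_poly_imp_sum[OF t(1)] by blast
  let ?P = "\<lambda>x. \<Sum>m\<in>S. p m * circle_exp m x"
  have PL2: "?P \<in> L2" by (intro L2_sum L2_cmult) auto
  have close: "cmod (h n x - ?P x) \<le> d * indicator {-pi..pi} x" for x
  proof (cases "x \<in> {-pi..pi}")
    case True
    \<comment> \<open>\<open>Arg (cis x) = x\<close> fails only at \<open>x = -pi\<close>, where
      \<open>Arg\<close> gives \<open>pi\<close>; there both sides vanish with the cutoff.\<close>
    have eq: "of_real (b n x) * q n x = of_real (b n x) * q n (Arg (cis x))"
    proof (cases "x = -pi")
      case False
      then show ?thesis using True by (simp add: Arg_cis)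
    qed (simp add: b_def)
    have "cmod (of_real (b n x) * q n (Arg (cis x)) - t x) \<le> d"
      using t(2)[of x] by (simp add: b_def)
    then show ?thesis
      using True unfolding S(2)[symmetric] h_def eq by simp
  qed (simp add: h_def flip: S(2))
  have "(l2_norm (\<lambda>x. h n x - ?P x))\<^sup>2 \<le> (\<integral>x. (d * indicator {-pi..pi} x)\<^sup>2 \<partial>lborel)"
    unfolding l2_norm_sq
    by (intro integral_mono L2_integrable L2_diff hL2 PL2 ind power_mono close norm_ge_zero)
  also have "\<dots> = (\<integral>x. d\<^sup>2 * indicator {-pi..pi} x \<partial>lborel)"
    by (intro Bochner_Integration.integral_cong) (auto simp: indicator_def)
  also have "\<dots> = (d * sqrt (2 * pi))\<^sup>2"
    by (simp add: power_mult_distrib)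
  finally have "l2_norm (\<lambda>x. h n x - ?P x) \<le> d * sqrt (2 * pi)"
    by (rule power2_le_imp_le) (use d in simp)
  also have "\<dots> < e / 3" using e by (simp add: d_def)
  finally have P: "l2_norm (\<lambda>x. h n x - ?P x) < e / 3" .
  have "l2_norm (\<lambda>x. G x - ?P x) \<le> l2_norm (\<lambda>x. G x - clamp_norm k (G x))
      + (l2_norm (\<lambda>x. clamp_norm k (G x) - h n x) + l2_norm (\<lambda>x. h n x - ?P x))"
    using l2_norm_triangle_diff[OF G clampL2 PL2] l2_norm_triangle_diff[OF clampL2 hL2 PL2, of n]
    by linarith
  then have "l2_norm (\<lambda>x. G x - ?P x) < e"
    using k n P by linarith
  with S(1) show thesis by (rule that)
qed

section \<open>Parseval's identity on intervals\<close>

lemma has_sum_nonnegI: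
  fixes f :: "'a \<Rightarrow> real"
  assumes nonneg: "\<And>x. x \<in> A \<Longrightarrow> 0 \<le> f x"
    and upper: "\<And>F. finite F \<Longrightarrow> F \<subseteq> A \<Longrightarrow> sum f F \<le> s"
    and lower: "\<And>e. e > 0 \<Longrightarrow> \<exists>F. finite F \<and> F \<subseteq> A \<and> s - e \<le> sum f F"
  shows "(f has_sum s) A"
proof -
  have bdd: "bdd_above (sum f ` {F. F \<subseteq> A \<and> finite F})"
    using upper by (auto intro!: bdd_aboveI2)
  then have "f summable_on A"
    using nonneg by (intro nonneg_bdd_above_summable_on)
  then have hs: "(f has_sum infsum f A) A" by (rule has_sum_infsum)
  have "infsum f A \<le> s"
    by (rule has_sum_le_finite_sums[OF hs]) (use upper in auto)
  moreover have "s - e \<le> infsum f A" if e: "e > 0" for e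
  proof -
    obtain F where "finite F" "F \<subseteq> A" "s - e \<le> sum f F" using lower[OF e] by blast
    then show ?thesis
      using finite_sum_le_has_sum[OF hs, of F] nonneg by fastforce
  qed
  then have "s \<le> infsum f A + e" if "e > 0" for e
    using that by (simp add: algebra_simps)
  then have "s \<le> infsum f A" by (rule field_le_epsilon)
  ultimately show ?thesis using hs by simp
qed

text \<open>The upper bound on finite sums is Bessel's inequality; the lower bound is density of the
  trigonometric polynomials, both through \<open>l2_norm_diff_trig\<close>.\<close>

lemma Parseval_pi:
  assumes G: "G \<in> L2" and supp: "\<And>x. x \<notin> {-pi..pi} \<Longrightarrow> G x = 0"
  shows "((\<lambda>m. (cmod (l2_inner G (circle_exp m)))\<^sup>2) has_sum 2 * pi * (l2_norm G)\<^sup>2) UNIV"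
proof (rule has_sum_nonnegI)
  fix F :: "int set" assume F: "finite F"
  have "0 \<le> (l2_norm (\<lambda>x. G x - (\<Sum>m\<in>F. (cnj (l2_inner G (circle_exp m)) / (2 * pi)) * circle_exp m x)))\<^sup>2"
    by simp
  then show "(\<Sum>m\<in>F. (cmod (l2_inner G (circle_exp m)))\<^sup>2) \<le> 2 * pi * (l2_norm G)\<^sup>2"
    unfolding l2_norm_diff_trig[OF G F] by (simp add: field_simps)
next
  fix e :: real assume e: "e > 0"
  \<comment> \<open>Chosen so that \<open>2 * pi\<close> times the squared approximation error is at
    most \<open>e\<close>.\<close>
  define d where "d = sqrt (e / (2 * pi))"
  have "d > 0" using e by (simp add: d_def)
  from trig_dense[OF G supp this] obtain S p
    where S: "finite S" "l2_norm (\<lambda>x. G x - (\<Sum>m\<in>S. p m * circle_exp m x)) < d" by blast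
  have "(l2_norm (\<lambda>x. G x - (\<Sum>m\<in>S. p m * circle_exp m x)))\<^sup>2 \<le> d\<^sup>2"
    using S(2) by (intro power_mono) auto
  also have "d\<^sup>2 = e / (2 * pi)" using e by (simp add: d_def)
  finally have "(l2_norm G)\<^sup>2 - (\<Sum>m\<in>S. (cmod (l2_inner G (circle_exp m)))\<^sup>2) / (2 * pi) \<le> e / (2 * pi)"
    unfolding l2_norm_diff_trig[OF G S(1)]
    by (smt (verit) mult_nonneg_nonneg pi_gt_zero sum_nonneg zero_le_power2)
  then have "2 * pi * ((l2_norm G)\<^sup>2 - (\<Sum>m\<in>S. (cmod (l2_inner G (circle_exp m)))\<^sup>2) / (2 * pi)) \<le> e"
    by (simp add: pos_le_divide_eq mult.commute)
  then have "2 * pi * (l2_norm G)\<^sup>2 - e \<le> (\<Sum>m\<in>S. (cmod (l2_inner G (circle_exp m)))\<^sup>2)"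
    by (simp add: right_diff_distrib)
  with S(1) show "\<exists>F. finite F \<and> F \<subseteq> UNIV \<and>
      2 * pi * (l2_norm G)\<^sup>2 - e \<le> (\<Sum>m\<in>F. (cmod (l2_inner G (circle_exp m)))\<^sup>2)"
    by blast
qed auto

lemma cis_measurable [measurable (raw)]:
  "f \<in> borel_measurable M \<Longrightarrow> (\<lambda>x. cis (f x)) \<in> borel_measurable M"
  by (rule borel_measurable_continuous_on[OF continuous_on_cis[OF continuous_on_id]])

text \<open>The substitution \<open>x = a + c * t\<close> with \<open>c = L / pi\<close> reduces to
  \<open>[-pi, pi]\<close>; the centre \<open>a\<close> contributes only a unimodular factor. The
  squared coefficients gain \<open>c\<^sup>2\<close>, the squared norm gains \<open>c\<close>, which
  leaves \<open>2 * pi * c = 2 * L\<close>.\<close>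

lemma Parseval_interval:
  assumes G: "G \<in> L2" and L: "L > 0"
    and supp: "AE x in lborel. x \<notin> {a - L..a + L} \<longrightarrow> G x = 0"
  shows "((\<lambda>m::int. (cmod (\<integral>x. G x * cis (- (of_int m * (pi / L) * x)) \<partial>lborel))\<^sup>2)
    has_sum 2 * L * (l2_norm G)\<^sup>2) UNIV"
proof -
  note [measurable] = L2_measurable[OF G]
  define c where "c = L / pi"
  have c: "c > 0" using L by (simp add: c_def)
  \<comment> \<open>\<open>G\<close> vanishes outside the interval only almost everywhere;
    \<open>K\<close> is the representative that vanishes there everywhere, as
    \<open>Parseval_pi\<close> demands.\<close>
  define K where "K x = indicator {a - L..a + L} x * G x" for x
  have KL2: "K \<in> L2" unfolding K_def using G by auto
  note [measurable] = L2_measurable[OF KL2]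
  have GK: "AE x in lborel. G x = K x"
    using supp by eventually_elim (auto simp: K_def indicator_def)
  have K0: "K x = 0" if "x \<notin> {a - L..a + L}" for x
    using that by (simp add: K_def)
  define H where "H t = K (a + c * t)" for t
  have [measurable]: "H \<in> borel_measurable borel" unfolding H_def by measurable
  have "integrable lborel (\<lambda>t. (cmod (H t))\<^sup>2)"
    unfolding H_def using lborel_integrable_real_affine[OF L2_integrable[OF KL2], of c a] c by simp
  then have HL2: "H \<in> L2" by (intro L2I) auto
  have "(\<integral>x. (cmod (K x))\<^sup>2 \<partial>lborel) = c * (\<integral>t. (cmod (H t))\<^sup>2 \<partial>lborel)"
    unfolding H_def using c by (subst lborel_integral_real_affine[of c _ a]) auto
  then have norm: "(l2_norm G)\<^sup>2 = c * (l2_norm H)\<^sup>2"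
    using l2_norm_AE_cong[OF GK] by (simp add: l2_norm_sq[symmetric])
  have supp': "H t = 0" if "t \<notin> {-pi..pi}" for t
  proof -
    have "a + c * t \<notin> {a - L..a + L}"
    proof
      assume "a + c * t \<in> {a - L..a + L}"
      then have "c * t \<le> c * pi" "c * (-pi) \<le> c * t" by (auto simp: c_def)
      then have "t \<le> pi" "-pi \<le> t" unfolding mult_le_cancel_left_pos[OF c] .
      then show False using that by auto
    qed
    then show ?thesis unfolding H_def by (rule K0)
  qed
  have coeff: "(cmod (\<integral>x. G x * cis (- (of_int m * (pi / L) * x)) \<partial>lborel))\<^sup>2
      = c\<^sup>2 * (cmod (l2_inner H (circle_exp m)))\<^sup>2" for m :: int
  proof -
    have "(\<integral>x. G x * cis (- (of_int m * (pi / L) * x)) \<partial>lborel)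
        = (\<integral>x. K x * cis (- (of_int m * (pi / L) * x)) \<partial>lborel)"
      by (rule integral_cong_AE) (use GK in auto)
    also have "\<dots> = c *\<^sub>R (\<integral>t. K (a + c * t) * cis (- (of_int m * (pi / L) * (a + c * t))) \<partial>lborel)"
      using c by (subst lborel_integral_real_affine[of c _ a]) auto
    also have "(\<integral>t. K (a + c * t) * cis (- (of_int m * (pi / L) * (a + c * t))) \<partial>lborel)
        = (\<integral>t. cis (- (of_int m * (pi / L) * a)) * cnj (cnj (H t) * circle_exp m t) \<partial>lborel)"
    proof (intro Bochner_Integration.integral_cong refl)
      fix t
      show "K (a + c * t) * cis (- (of_int m * (pi / L) * (a + c * t)))
          = cis (- (of_int m * (pi / L) * a)) * cnj (cnj (H t) * circle_exp m t)"
      proof (cases "t \<in> {-pi..pi}")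
        case True
        have "(of_int m * (pi / L) * (a + c * t)) = of_int m * (pi / L) * a + of_int m * t"
          using L by (simp add: c_def field_simps)
        then have "cis (- (of_int m * (pi / L) * (a + c * t)))
            = cis (- (of_int m * (pi / L) * a)) * cis (- (of_int m * t))"
          by (simp add: cis_mult)
        then show ?thesis
          using True by (simp add: H_def circle_exp_def cis_cnj)
      qed (use supp'[of t] in \<open>simp add: H_def\<close>)
    qed
    also have "\<dots> = cis (- (of_int m * (pi / L) * a)) * cnj (l2_inner H (circle_exp m))"
      by (simp only: integral_mult_right_zero Bochner_Integration.integral_cnj l2_inner_def)
    finally show ?thesis
      using c by (simp add: norm_mult power_mult_distrib)
  qed
  have "((\<lambda>m. c\<^sup>2 * (cmod (l2_inner H (circle_exp m)))\<^sup>2) has_sum c\<^sup>2 * (2 * pi * (l2_norm H)\<^sup>2)) UNIV"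
    by (intro has_sum_cmult_right Parseval_pi HL2 supp')
  also have "c\<^sup>2 * (2 * pi * (l2_norm H)\<^sup>2) = 2 * L * (l2_norm G)\<^sup>2"
    unfolding norm using L by (simp add: c_def power2_eq_square field_simps)
  finally show ?thesis unfolding coeff .
qed

text \<open>Monotone convergence for a series over the integers; \<open>int_decode\<close>
  enumerates them to reach a series over the naturals.\<close>

lemma nn_integral_has_sum_int:
  fixes f :: "int \<Rightarrow> 'a \<Rightarrow> real"
  assumes [measurable]: "\<And>n. f n \<in> borel_measurable M"
    and nonneg: "\<And>n x. 0 \<le> f n x"
    and sum: "\<And>x. x \<in> space M \<Longrightarrow> ((\<lambda>n. f n x) has_sum s x) UNIV"
  shows "(\<integral>\<^sup>+x. ennreal (s x) \<partial>M) = (\<Sum>k. \<integral>\<^sup>+x. ennreal (f (int_decode k) x) \<partial>M)"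
proof -
  have "(\<integral>\<^sup>+x. ennreal (s x) \<partial>M) = (\<integral>\<^sup>+x. (\<Sum>k. ennreal (f (int_decode k) x)) \<partial>M)"
  proof (intro nn_integral_cong)
    fix x assume "x \<in> space M"
    then have "((\<lambda>k. f (int_decode k) x) has_sum s x) UNIV"
      using sum has_sum_reindex_bij_betw[OF bij_int_decode, of "\<lambda>n. f n x" "s x"] by simp
    then have "(\<lambda>k. f (int_decode k) x) sums s x"
      by (rule has_sum_imp_sums)
    then show "ennreal (s x) = (\<Sum>k. ennreal (f (int_decode k) x))"
      using nonneg by (metis suminf_ennreal_eq)
  qed
  also have "\<dots> = (\<Sum>k. \<integral>\<^sup>+x. ennreal (f (int_decode k) x) \<partial>M)"
    by (intro nn_integral_suminf) measurable
  finally show ?thesis .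
qed

section \<open>Plancherel's theorem\<close>

text \<open>Meant for \<open>L2\<close> functions of bounded support, where the integral converges
  absolutely; \<open>fourier_trunc\<close> is this transform of the truncated function.\<close>

definition fourier_integral :: "(real \<Rightarrow> complex) \<Rightarrow> real \<Rightarrow> complex" where
  "fourier_integral f w = complex_of_real (1 / sqrt (2 * pi)) * (\<integral>x. f x * cis (- (w * x)) \<partial>lborel)"

lemma fourier_trunc_eq_integral: "fourier_trunc f N = fourier_integral (\<lambda>x. indicator {- real N..real N} x * f x)"
  unfolding fun_eq_iff fourier_trunc_def fourier_integral_def set_lebesgue_integral_def
  by (auto intro!: Bochner_Integration.integral_cong simp: indicator_def cis_conv_exp scaleR_conv_of_real)

lemma fourier_integral_measurable [measurable]:
  assumes [measurable]: "f \<in> borel_measurable borel"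
  shows "fourier_integral f \<in> borel_measurable borel"
proof -
  have "(\<lambda>w. \<integral>x. f x * cis (- (w * x)) \<partial>lborel) \<in> borel_measurable borel"
    by (rule lborel.borel_measurable_lebesgue_integral) measurable
  then show ?thesis unfolding fourier_integral_def by measurable
qed

text \<open>Parseval's identity for \<open>f(x) e\<^sup>-\<^sup>i\<^sup>s\<^sup>x\<close> evaluates the sum of \<open>\<bar>fourier_integral f\<bar>\<^sup>2\<close> over a lattice shifted by \<open>s\<close>;
  it does not depend on \<open>s\<close>, and integrating over \<open>s\<close> in one period gives Plancherel's theorem.\<close>

lemma Plancherel_bounded_support:
  assumes f: "f \<in> L2" and R: "R > 0"
    and supp: "\<And>x. x \<notin> {-R..R} \<Longrightarrow> f x = 0"
  shows "fourier_integral f \<in> L2" "l2_norm (fourier_integral f) = l2_norm f"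
proof -
  note [measurable] = L2_measurable[OF f] fourier_integral_measurable[OF L2_measurable[OF f]]
  define w where "w = pi / R"
  have w: "w > 0" using R by (simp add: w_def)
  \<comment> \<open>\<open>2 * R * (l2_norm f)\<^sup>2\<close> comes from Parseval's identity, the
    divisor \<open>2 * pi\<close> from the normalisation of \<open>fourier_integral\<close>.\<close>
  define c where "c = 2 * R * (l2_norm f)\<^sup>2 / (2 * pi)"
  have c: "c \<ge> 0" using R by (simp add: c_def)
  have lattice: "((\<lambda>m::int. (cmod (fourier_integral f (s + of_int m * w)))\<^sup>2) has_sum c) UNIV" for s
  proof -
    define G where "G x = f x * cis (- (s * x))" for x
    have cmodG: "cmod (G x) = cmod (f x)" for x by (simp add: G_def norm_mult)
    have [measurable]: "G \<in> borel_measurable borel" unfolding G_def by measurable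
    have GL2: "G \<in> L2" by (rule L2_dominated[OF _ f, of _ 1]) (auto simp: cmodG)
    have normG: "l2_norm G = l2_norm f" by (simp add: l2_norm_def cmodG)
    have coeff: "(cmod (fourier_integral f (s + of_int m * w)))\<^sup>2
        = (cmod (\<integral>x. G x * cis (- (of_int m * (pi / R) * x)) \<partial>lborel))\<^sup>2 / (2 * pi)" for m :: int
    proof -
      have "(\<integral>x. f x * cis (- ((s + of_int m * w) * x)) \<partial>lborel)
          = (\<integral>x. G x * cis (- (of_int m * (pi / R) * x)) \<partial>lborel)"
        by (intro Bochner_Integration.integral_cong)
           (auto simp: G_def w_def mult.assoc cis_mult algebra_simps)
      then show ?thesis
        by (simp add: fourier_integral_def norm_mult norm_divide power_divide)
    qed
    have "AE x in lborel. x \<notin> {0 - R..0 + R} \<longrightarrow> G x = 0"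
      using supp by (auto simp: G_def)
    from has_sum_divide_const[OF Parseval_interval[OF GL2 R this], of "2 * pi"]
    show ?thesis unfolding coeff normG c_def .
  qed
  have "(\<integral>\<^sup>+x. ennreal ((cmod (fourier_integral f x))\<^sup>2) \<partial>lborel)
      = (\<Sum>k. \<integral>\<^sup>+x. ennreal (indicator {of_int (int_decode k) * w..<(of_int (int_decode k) + 1) * w} x
          * (cmod (fourier_integral f x))\<^sup>2) \<partial>lborel)"
  proof (rule nn_integral_has_sum_int)
    fix x :: real
    \<comment> \<open>The cells \<open>[m w, (m + 1) w)\<close> partition the line;
      \<open>?m\<close> is the index of the one containing \<open>x\<close>, so only one term
      survives.\<close>
    let ?m = "\<lfloor>x / w\<rfloor>"
    have "x \<in> {of_int m * w..<(of_int m + 1) * w} \<longleftrightarrow> m = ?m" for m :: int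
      using w floor_eq_iff[of "x / w" m] by (auto simp: pos_le_divide_eq pos_divide_less_eq)
    then have "(\<lambda>m::int. indicator {of_int m * w..<(of_int m + 1) * w} x * (cmod (fourier_integral f x))\<^sup>2)
        = (\<lambda>m. if m = ?m then (cmod (fourier_integral f x))\<^sup>2 else 0)"
      by (auto simp: indicator_def fun_eq_iff)
    moreover have "((\<lambda>m. if m = ?m then (cmod (fourier_integral f x))\<^sup>2 else 0) has_sum (cmod (fourier_integral f x))\<^sup>2) UNIV"
      by (rule has_sum_finite_neutralI[of "{?m}"]) auto
    ultimately show "((\<lambda>m::int. indicator {of_int m * w..<(of_int m + 1) * w} x * (cmod (fourier_integral f x))\<^sup>2)
        has_sum (cmod (fourier_integral f x))\<^sup>2) UNIV"
      by simp
  qed auto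
  also have "\<dots> = (\<Sum>k. \<integral>\<^sup>+s. ennreal (indicator {0..<w} s
      * (cmod (fourier_integral f (s + of_int (int_decode k) * w)))\<^sup>2) \<partial>lborel)"
  proof (intro suminf_cong)
    fix k
    let ?t = "of_int (int_decode k) * w"
    have "indicator {?t..<(of_int (int_decode k) + 1) * w} (?t + 1 * s) = (indicator {0..<w} s :: real)" for s
      by (auto simp: indicator_def algebra_simps)
    then show "(\<integral>\<^sup>+x. ennreal (indicator {?t..<(of_int (int_decode k) + 1) * w} x
          * (cmod (fourier_integral f x))\<^sup>2) \<partial>lborel)
        = (\<integral>\<^sup>+s. ennreal (indicator {0..<w} s * (cmod (fourier_integral f (s + ?t)))\<^sup>2) \<partial>lborel)"
      by (subst nn_integral_real_affine[of _ 1 ?t]) (auto simp: add.commute)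
  qed
  also have "\<dots> = (\<integral>\<^sup>+s. ennreal (indicator {0..<w} s * c) \<partial>lborel)"
    by (rule nn_integral_has_sum_int[symmetric, OF _ _ has_sum_cmult_right[OF lattice]]) auto
  also have "\<dots> = ennreal (c * w)"
  proof -
    have "(\<integral>\<^sup>+s. ennreal (indicator {0..<w} s * c) \<partial>lborel)
        = (\<integral>\<^sup>+s. ennreal c * indicator {0..<w} s \<partial>lborel)"
      by (intro nn_integral_cong) (auto simp: indicator_def)
    also have "\<dots> = ennreal c * ennreal w"
      using w by (subst nn_integral_cmult_indicator) (simp_all)
    finally show ?thesis using w c by (simp add: ennreal_mult)
  qed
  \<comment> \<open>The lattice spacing \<open>w = pi / R\<close> cancels the factor
    \<open>2 * R / (2 * pi)\<close>.\<close>
  also have "c * w = (l2_norm f)\<^sup>2"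
    using R by (simp add: w_def c_def)
  finally have *: "(\<integral>\<^sup>+x. ennreal ((cmod (fourier_integral f x))\<^sup>2) \<partial>lborel) = ennreal ((l2_norm f)\<^sup>2)" .
  show "fourier_integral f \<in> L2"
    by (rule L2_nn_integralI(1)[OF _ *]) auto
  have "(l2_norm (fourier_integral f))\<^sup>2 = (l2_norm f)\<^sup>2"
    by (rule L2_nn_integralI(2)[OF _ *]) auto
  then show "l2_norm (fourier_integral f) = l2_norm f"
    by (simp add: power2_eq_iff_nonneg)
qed

section \<open>The Fourier transform on all of \<open>L2\<close>\<close>

text \<open>On a set of finite measure \<open>L2\<close> embeds in \<open>L1\<close>: the indicator
  is itself in \<open>L2\<close>, and a product of two \<open>L2\<close> functions is
  integrable.\<close>

lemma L2_cutoff_integrable: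
  assumes "f \<in> L2" "S \<in> sets borel" "emeasure lborel S < \<infinity>" and [measurable]: "g \<in> borel_measurable borel"
    and "\<And>x. cmod (g x) \<le> 1"
  shows "integrable lborel (\<lambda>x. indicator S x * f x * g x)"
proof -
  note [measurable] = L2_measurable[OF assms(1)] assms(2)
  have "(indicator S :: real \<Rightarrow> complex) \<in> L2"
  proof (rule L2I)
    have "(\<lambda>x. (cmod (indicator S x))\<^sup>2) = indicator S"
      by (auto simp: indicator_def)
    then show "integrable lborel (\<lambda>x. (cmod (indicator S x))\<^sup>2)"
      using assms(2,3) by simp
  qed measurable
  from L2_mult_integrable[OF this assms(1)] show ?thesis
    by (rule Bochner_Integration.integrable_bound)
       (use assms(5) in \<open>auto simp: norm_mult mult_left_le\<close>)
qed

lemma fourier_trunc_integrable: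
  assumes "f \<in> L2"
  shows "integrable lborel (\<lambda>x. indicator {- real N..real N} x * f x * cis (- (w * x)))"
  by (rule L2_cutoff_integrable[OF assms]) auto

lemma fourier_trunc_add:
  assumes "f \<in> L2" "g \<in> L2"
  shows "fourier_trunc (\<lambda>x. f x + c * g x) N w = fourier_trunc f N w + c * fourier_trunc g N w"
proof -
  have "(\<integral>x. indicator {- real N..real N} x * (f x + c * g x) * cis (- (w * x)) \<partial>lborel)
      = (\<integral>x. indicator {- real N..real N} x * f x * cis (- (w * x))
          + c * (indicator {- real N..real N} x * g x * cis (- (w * x))) \<partial>lborel)"
    by (intro Bochner_Integration.integral_cong) (auto simp: algebra_simps)
  also have "\<dots> = (\<integral>x. indicator {- real N..real N} x * f x * cis (- (w * x)) \<partial>lborel)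
      + c * (\<integral>x. indicator {- real N..real N} x * g x * cis (- (w * x)) \<partial>lborel)"
    using fourier_trunc_integrable[OF assms(1), of N w] fourier_trunc_integrable[OF assms(2), of N w]
    by (simp add: Bochner_Integration.integral_add)
  finally show ?thesis
    unfolding fourier_trunc_eq_integral fourier_integral_def by (simp add: algebra_simps)
qed

lemma fourier_trunc_L2:
  assumes "f \<in> L2"
  shows "fourier_trunc f N \<in> L2"
  unfolding fourier_trunc_eq_integral
  \<comment> \<open>The radius must be positive even for \<open>N = 0\<close>, hence the added
    1.\<close>
  by (rule Plancherel_bounded_support[of _ "real N + 1"]) (use L2_indicator[OF assms, of "{- real N..real N}"] in \<open>auto simp: indicator_def\<close>)

lemma l2_norm_fourier_trunc:
  assumes "f \<in> L2"
  shows "l2_norm (fourier_trunc f N) = l2_norm (\<lambda>x. indicator {- real N..real N} x * f x)"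
  unfolding fourier_trunc_eq_integral
  by (rule Plancherel_bounded_support[of _ "real N + 1"]) (use L2_indicator[OF assms, of "{- real N..real N}"] in \<open>auto simp: indicator_def\<close>)

text \<open>A difference of truncated transforms is the transform of a function of bounded support,
  so Plancherel's theorem applies to it; this transfers the Cauchy property from the truncations of
  \<open>f\<close> to their transforms.\<close>

lemma l2_norm_fourier_trunc_diff:
  assumes f: "f \<in> L2"
  shows "l2_norm (\<lambda>x. fourier_trunc f M x - fourier_trunc f N x)
    = l2_norm (\<lambda>x. indicator {- real M..real M} x * f x - indicator {- real N..real N} x * f x)"
    (is "_ = l2_norm ?h")
proof -
  have "fourier_integral ?h w = fourier_trunc f M w - fourier_trunc f N w" for w
    unfolding fourier_trunc_eq_integral fourier_integral_def
    using fourier_trunc_integrable[OF f, of M w] fourier_trunc_integrable[OF f, of N w]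
    by (simp add: left_diff_distrib right_diff_distrib)
  then have "l2_norm (\<lambda>x. fourier_trunc f M x - fourier_trunc f N x) = l2_norm (fourier_integral ?h)"
    by (intro arg_cong[of _ _ l2_norm] ext) simp
  also have "l2_norm (fourier_integral ?h) = l2_norm ?h"
    by (rule Plancherel_bounded_support[of _ "real M + real N + 1"])
       (use L2_diff[OF L2_indicator[OF f, of "{- real M..real M}"]
          L2_indicator[OF f, of "{- real N..real N}"]] in \<open>auto simp: indicator_def\<close>)
  finally show ?thesis .
qed

lemma l2_norm_trunc_tendsto:
  assumes f: "f \<in> L2"
  shows "(\<lambda>N. l2_norm (\<lambda>x. indicator {- real N..real N} x * f x - f x)) \<longlonglongrightarrow> 0"
proof (rule tendsto_l2_norm_dominated[where w = "\<lambda>x. cmod (f x)"])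
  note [measurable] = L2_measurable[OF f]
  show "(\<lambda>x. indicator {- real N..real N} x * f x) \<in> borel_measurable borel" for N
    by measurable
  show "AE x in lborel. (\<lambda>N. indicator {- real N..real N} x * f x) \<longlonglongrightarrow> f x"
  proof (intro AE_I2 tendsto_eventually)
    fix x
    show "\<forall>\<^sub>F N in sequentially. indicator {- real N..real N} x * f x = f x"
      using eventually_ge_at_top[of "nat \<lceil>\<bar>x\<bar>\<rceil>"]
    proof eventually_elim
      case (elim N)
      then have "\<bar>x\<bar> \<le> real N" by linarith
      then show ?case by (auto simp: indicator_def)
    qed
  qed
qed (use f L2_integrable[OF f] L2_measurable[OF f] in \<open>auto simp: indicator_def\<close>)

lemma is_fourier_iff:
  assumes "f \<in> L2" "g \<in> L2"
  shows "is_fourier f g \<longleftrightarrow> (\<lambda>N. l2_norm (\<lambda>w. fourier_trunc f N w - g w)) \<longlonglongrightarrow> 0"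
proof -
  have "(\<integral>\<^sup>+w. ennreal ((cmod (g w - fourier_trunc f N w))\<^sup>2) \<partial>lborel)
      = ennreal ((l2_norm (\<lambda>w. fourier_trunc f N w - g w))\<^sup>2)" for N
    using nn_integral_L2[OF L2_diff[OF assms(2) fourier_trunc_L2[OF assms(1)]]]
    by (simp add: l2_norm_diff_commute)
  then have "is_fourier f g \<longleftrightarrow>
      (\<lambda>N. ennreal ((l2_norm (\<lambda>w. fourier_trunc f N w - g w))\<^sup>2)) \<longlonglongrightarrow> ennreal 0"
    using assms by (simp add: is_fourier_def)
  also have "\<dots> \<longleftrightarrow> (\<lambda>N. (l2_norm (\<lambda>w. fourier_trunc f N w - g w))\<^sup>2) \<longlonglongrightarrow> 0"
    by (subst tendsto_ennreal_iff) auto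
  also have "\<dots> \<longleftrightarrow> (\<lambda>N. l2_norm (\<lambda>w. fourier_trunc f N w - g w)) \<longlonglongrightarrow> 0"
    by (rule power_tendsto_0_iff) simp
  finally show ?thesis .
qed

lemma is_fourier_L2: "is_fourier f g \<Longrightarrow> f \<in> L2" "is_fourier f g \<Longrightarrow> g \<in> L2"
  by (auto simp: is_fourier_def)

lemma is_fourier_tendsto:
  "is_fourier f g \<Longrightarrow> (\<lambda>N. l2_norm (\<lambda>w. fourier_trunc f N w - g w)) \<longlonglongrightarrow> 0"
  using is_fourier_iff is_fourier_L2 by blast

lemma is_fourier_exists:
  assumes f: "f \<in> L2"
  obtains g where "is_fourier f g"
proof (rule L2_complete[of "fourier_trunc f"])
  fix e :: real assume e: "e > 0"
  let ?t = "\<lambda>N x. indicator {- real N..real N} x * f x"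
  from LIMSEQ_D[OF l2_norm_trunc_tendsto[OF f], of "e / 2"] e obtain M
    where M: "\<And>N. N \<ge> M \<Longrightarrow> l2_norm (\<lambda>x. ?t N x - f x) < e / 2" by auto
  have "l2_norm (\<lambda>x. fourier_trunc f m x - fourier_trunc f n x) < e" if "m \<ge> M" "n \<ge> M" for m n
  proof -
    have t: "?t N \<in> L2" for N using f by auto
    have "l2_norm (\<lambda>x. ?t m x - ?t n x) \<le> l2_norm (\<lambda>x. ?t m x - f x) + l2_norm (\<lambda>x. f x - ?t n x)"
      by (rule l2_norm_triangle_diff[OF t f t])
    then show ?thesis
      unfolding l2_norm_fourier_trunc_diff[OF f]
      using M[OF that(1)] M[OF that(2)] l2_norm_diff_commute[of f "?t n"] by linarith
  qed
  then show "\<exists>M. \<forall>m\<ge>M. \<forall>n\<ge>M. l2_norm (\<lambda>x. fourier_trunc f m x - fourier_trunc f n x) < e"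
    by blast
next
  fix g assume "g \<in> L2" "(\<lambda>n. l2_norm (\<lambda>x. fourier_trunc f n x - g x)) \<longlonglongrightarrow> 0"
  then show thesis
    using is_fourier_iff[OF f] that by blast
qed (rule fourier_trunc_L2[OF f])

lemma is_fourier_fourier: "f \<in> L2 \<Longrightarrow> is_fourier f (fourier f)"
  unfolding fourier_def by (metis is_fourier_exists someI)

text \<open>The scalar \<open>c\<close> is built in so that the conclusion matches the hypothesis of
  \<open>l2_inner_polarization\<close>.\<close>

lemma is_fourier_add:
  assumes "is_fourier f F" "is_fourier g G"
  shows "is_fourier (\<lambda>x. f x + c * g x) (\<lambda>x. F x + c * G x)"
proof -
  note L2 = is_fourier_L2[OF assms(1)] is_fourier_L2[OF assms(2)]
  let ?f = "\<lambda>N x. fourier_trunc f N x - F x" and ?g = "\<lambda>N x. fourier_trunc g N x - G x"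
  have "(\<lambda>N. l2_norm (\<lambda>w. fourier_trunc (\<lambda>x. f x + c * g x) N w - (F w + c * G w))) \<longlonglongrightarrow> 0"
  proof (rule Lim_null_comparison)
    show "\<forall>\<^sub>F N in sequentially. norm (l2_norm (\<lambda>w. fourier_trunc (\<lambda>x. f x + c * g x) N w - (F w + c * G w)))
        \<le> l2_norm (?f N) + cmod c * l2_norm (?g N)"
    proof (intro always_eventually allI)
      fix N
      have "(\<lambda>w. fourier_trunc (\<lambda>x. f x + c * g x) N w - (F w + c * G w)) = (\<lambda>w. ?f N w + c * ?g N w)"
        by (simp add: fun_eq_iff fourier_trunc_add[OF L2(1,3)] algebra_simps)
      moreover have "l2_norm (\<lambda>w. ?f N w + c * ?g N w) \<le> l2_norm (?f N) + l2_norm (\<lambda>w. c * ?g N w)"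
        using L2 by (intro l2_norm_triangle L2_cmult L2_diff fourier_trunc_L2)
      ultimately show "norm (l2_norm (\<lambda>w. fourier_trunc (\<lambda>x. f x + c * g x) N w - (F w + c * G w)))
          \<le> l2_norm (?f N) + cmod c * l2_norm (?g N)"
        by (simp only: l2_norm_cmult real_norm_def abs_of_nonneg[OF l2_norm_nonneg])
    qed
    show "(\<lambda>N. l2_norm (?f N) + cmod c * l2_norm (?g N)) \<longlonglongrightarrow> 0"
      using is_fourier_tendsto[OF assms(1)] is_fourier_tendsto[OF assms(2)]
      by (auto intro!: tendsto_eq_intros)
  qed
  then show ?thesis
    using L2 by (subst is_fourier_iff) (auto intro: L2_add L2_cmult)
qed

lemma l2_norm_is_fourier:
  assumes "is_fourier f g"
  shows "l2_norm g = l2_norm f"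
proof -
  note L2 = is_fourier_L2[OF assms]
  have "(\<lambda>N. l2_norm (fourier_trunc f N)) \<longlonglongrightarrow> l2_norm g"
    by (rule tendsto_l2_norm[OF fourier_trunc_L2[OF L2(1)] L2(2) is_fourier_tendsto[OF assms]])
  moreover have "(\<lambda>N. l2_norm (fourier_trunc f N)) \<longlonglongrightarrow> l2_norm f"
    unfolding l2_norm_fourier_trunc[OF L2(1)]
    by (rule tendsto_l2_norm[OF _ L2(1) l2_norm_trunc_tendsto[OF L2(1)]]) (use L2 in auto)
  ultimately show ?thesis by (rule LIMSEQ_unique)
qed

lemma l2_inner_is_fourier:
  assumes "is_fourier f F" "is_fourier g G"
  shows "l2_inner F G = l2_inner f g"
  by (rule l2_inner_polarization)
     (use assms is_fourier_L2 l2_norm_is_fourier is_fourier_add in blast)+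

text \<open>By linearity \<open>g - h\<close> is a transform of \<open>f - f = 0\<close>, and the
  transform preserves the norm.\<close>

lemma is_fourier_unique:
  assumes "is_fourier f g" "is_fourier f h"
  shows "AE x in lborel. g x = h x"
proof -
  have "l2_norm (\<lambda>x. g x + (-1) * h x) = l2_norm (\<lambda>x. f x + (-1) * f x)"
    by (rule l2_norm_is_fourier[OF is_fourier_add[OF assms]])
  also have "\<dots> = 0" by (simp add: l2_norm_def)
  finally have "l2_norm (\<lambda>x. g x - h x) = 0" by simp
  then have "AE x in lborel. g x - h x = 0"
    using l2_norm_eq_0_iff[OF L2_diff[OF is_fourier_L2(2)[OF assms(1)] is_fourier_L2(2)[OF assms(2)]]]
    by simp
  then show ?thesis by simp
qed

section \<open>Adjoint and surjectivity of the Fourier transform\<close>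

lemma lborel_integrable_product:
  fixes a b :: "real \<Rightarrow> complex"
  assumes a: "integrable lborel a" and b: "integrable lborel b"
  shows "integrable (lborel \<Otimes>\<^sub>M lborel) (\<lambda>(x, y). a x * b y)"
proof (rule lborel_pair.Fubini_integrable)
  note [measurable] = borel_measurable_integrable[OF a] borel_measurable_integrable[OF b]
  show "(\<lambda>(x, y). a x * b y) \<in> borel_measurable (lborel \<Otimes>\<^sub>M lborel)" by measurable
  show "integrable lborel (\<lambda>x. \<integral>y. norm (case (x, y) of (x, y) \<Rightarrow> a x * b y) \<partial>lborel)"
    using integrable_norm[OF a] by (simp add: norm_mult)
  show "AE x in lborel. integrable lborel (\<lambda>y. case (x, y) of (x, y) \<Rightarrow> a x * b y)"
    using b by simp
qed

lemma cnj_indicator [simp]: "cnj (indicator S x) = indicator S x"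
  by (simp add: indicator_def)

text \<open>Fubini's theorem. Truncating on both sides makes both factors integrable, hence the
  kernel integrable on the plane.\<close>

lemma fourier_trunc_adjoint:
  assumes f: "f \<in> L2" and h: "h \<in> L2"
  shows "l2_inner (fourier_trunc f N) (\<lambda>w. indicator {- real N..real N} w * h w)
    = l2_inner (\<lambda>x. indicator {- real N..real N} x * f x) (\<lambda>x. cnj (fourier_trunc (\<lambda>w. cnj (h w)) N x))"
proof -
  let ?I = "\<lambda>x. indicator {- real N..real N} x :: complex"
  let ?c = "complex_of_real (1 / sqrt (2 * pi))"
  note [measurable] = L2_measurable[OF f] L2_measurable[OF h]
  define k where "k x w = ?c * (cnj (?I x * f x) * (?I w * h w) * cis (w * x))" for x w
  have int: "integrable (lborel \<Otimes>\<^sub>M lborel) (\<lambda>(x, w). k x w)"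
  proof -
    have "integrable lborel (\<lambda>x. ?I x * cnj (f x) * 1)" "integrable lborel (\<lambda>x. ?I x * h x * 1)"
      by (rule L2_cutoff_integrable; use f h in auto)+
    then have "integrable (lborel \<Otimes>\<^sub>M lborel) (\<lambda>(x, w). (?I x * cnj (f x)) * (?I w * h w))"
      by (intro lborel_integrable_product) simp_all
    then show ?thesis
    proof (rule Bochner_Integration.integrable_bound)
      have "norm (k x w) \<le> norm ((?I x * cnj (f x)) * (?I w * h w))" for x w
      proof -
        have "sqrt (2 * pi) \<ge> 1" using pi_ge_two by (simp add: real_le_rsqrt)
        then have "norm (k x w) \<le> 1 * norm ((?I x * cnj (f x)) * (?I w * h w))"
          unfolding k_def norm_mult norm_cis mult_1_right complex_mod_cnj
          by (intro mult_right_mono) (auto simp: norm_mult norm_divide)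
        then show ?thesis by simp
      qed
      then show "AE z in lborel \<Otimes>\<^sub>M lborel. norm (case z of (x, w) \<Rightarrow> k x w)
          \<le> norm (case z of (x, w) \<Rightarrow> ?I x * cnj (f x) * (?I w * h w))"
        by auto
    qed (simp add: k_def)
  qed
  have "l2_inner (fourier_trunc f N) (\<lambda>w. ?I w * h w) = (\<integral>w. (\<integral>x. k x w \<partial>lborel) \<partial>lborel)"
    unfolding l2_inner_def
  proof (intro Bochner_Integration.integral_cong refl)
    fix w
    have "cnj (fourier_trunc f N w) = ?c * (\<integral>x. cnj (?I x * f x * cis (- (w * x))) \<partial>lborel)"
      unfolding fourier_trunc_eq_integral fourier_integral_def Bochner_Integration.integral_cnj by simp
    also have "\<dots> * (?I w * h w) = (\<integral>x. k x w \<partial>lborel)"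
      unfolding k_def by (simp add: cis_cnj mult_ac flip: integral_mult_right_zero)
    finally show "cnj (fourier_trunc f N w) * (?I w * h w) = (\<integral>x. k x w \<partial>lborel)" .
  qed
  also have "\<dots> = (\<integral>x. (\<integral>w. k x w \<partial>lborel) \<partial>lborel)"
    by (rule lborel_pair.Fubini_integral[OF int])
  also have "\<dots> = l2_inner (\<lambda>x. ?I x * f x) (\<lambda>x. cnj (fourier_trunc (\<lambda>w. cnj (h w)) N x))"
    unfolding l2_inner_def
  proof (intro Bochner_Integration.integral_cong refl)
    fix x
    have "cnj (fourier_trunc (\<lambda>w. cnj (h w)) N x) = ?c * (\<integral>w. cnj (?I w * cnj (h w) * cis (- (x * w))) \<partial>lborel)"
      unfolding fourier_trunc_eq_integral fourier_integral_def Bochner_Integration.integral_cnj by simp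
    then show "(\<integral>w. k x w \<partial>lborel) = cnj (?I x * f x) * cnj (fourier_trunc (\<lambda>w. cnj (h w)) N x)"
      unfolding k_def by (simp add: cis_cnj mult_ac flip: integral_mult_right_zero)
  qed
  finally show ?thesis .
qed

text \<open>The exponential kernel is symmetric in its two variables, so the adjoint is the
  transform conjugated before and after; the truncated identity passes to the limit by continuity of
  the inner product.\<close>

lemma is_fourier_adjoint:
  assumes fF: "is_fourier f F" and hk: "is_fourier (\<lambda>w. cnj (h w)) k"
  shows "l2_inner F h = l2_inner f (\<lambda>x. cnj (k x))"
proof -
  have f: "f \<in> L2" "F \<in> L2" using is_fourier_L2[OF fF] .
  have k: "(\<lambda>w. cnj (h w)) \<in> L2" "k \<in> L2" using is_fourier_L2[OF hk] .
  have h: "h \<in> L2" using L2_cnj[OF k(1)] by simp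
  have t: "(\<lambda>x. indicator {- real N..real N} x * f x) \<in> L2"
    "(\<lambda>x. indicator {- real N..real N} x * h x) \<in> L2" for N
    using f h by auto
  have "(\<lambda>N. l2_inner (fourier_trunc f N) (\<lambda>w. indicator {- real N..real N} w * h w)) \<longlonglongrightarrow> l2_inner F h"
    by (rule tendsto_l2_inner[OF fourier_trunc_L2[OF f(1)] t(2) f(2) h is_fourier_tendsto[OF fF]
        l2_norm_trunc_tendsto[OF h]])
  moreover have "(\<lambda>N. l2_norm (\<lambda>x. cnj (fourier_trunc (\<lambda>w. cnj (h w)) N x) - cnj (k x))) \<longlonglongrightarrow> 0"
    using is_fourier_tendsto[OF hk] by (simp add: l2_norm_def flip: complex_cnj_diff)
  then have "(\<lambda>N. l2_inner (\<lambda>x. indicator {- real N..real N} x * f x)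
      (\<lambda>x. cnj (fourier_trunc (\<lambda>w. cnj (h w)) N x))) \<longlonglongrightarrow> l2_inner f (\<lambda>x. cnj (k x))"
    by (intro tendsto_l2_inner t(1) L2_cnj fourier_trunc_L2 k f(1) l2_norm_trunc_tendsto)
  ultimately show ?thesis
    unfolding fourier_trunc_adjoint[OF f(1) h] by (rule LIMSEQ_unique)
qed

text \<open>With the adjoint \<open>f\<close> of \<open>h\<close>, \<open>\<parallel>F f - h\<parallel>\<^sup>2 = \<parallel>f\<parallel>\<^sup>2 - 2 \<langle>f, f\<rangle> + \<parallel>h\<parallel>\<^sup>2 = 0\<close>, as both the transform
  and its adjoint are isometric.\<close>

lemma is_fourier_surj:
  assumes h: "h \<in> L2"
  obtains f where "is_fourier f h"
proof -
  obtain k where k: "is_fourier (\<lambda>w. cnj (h w)) k"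
    using is_fourier_exists[OF L2_cnj[OF h]] .
  define f where "f x = cnj (k x)" for x
  have f: "f \<in> L2" unfolding f_def using is_fourier_L2[OF k] by auto
  obtain F where F: "is_fourier f F" using is_fourier_exists[OF f] .
  have FL2: "F \<in> L2" using is_fourier_L2[OF F] by auto
  have nf: "l2_norm f = l2_norm h"
    using l2_norm_is_fourier[OF k] by (simp add: f_def l2_norm_def)
  have "l2_inner F h = l2_inner f f"
    using is_fourier_adjoint[OF F k] by (simp add: f_def[abs_def])
  then have "(l2_norm (\<lambda>x. F x - h x))\<^sup>2 = 0"
    unfolding l2_norm_diff_sq[OF FL2 h] by (simp add: l2_inner_self l2_norm_is_fourier[OF F] nf)
  then have AE: "AE x in lborel. F x - h x = 0"
    using l2_norm_eq_0_iff[OF L2_diff[OF FL2 h]] by simp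
  note [measurable] = L2_measurable[OF FL2] L2_measurable[OF h] L2_measurable[OF fourier_trunc_L2[OF f]]
  have "l2_norm (\<lambda>w. fourier_trunc f N w - F w) = l2_norm (\<lambda>w. fourier_trunc f N w - h w)" for N
    by (rule l2_norm_AE_cong) (use AE in auto)
  then have "is_fourier f h"
    using is_fourier_tendsto[OF F] by (simp add: is_fourier_iff[OF f h])
  then show thesis by (rule that)
qed

section \<open>The tight frame\<close>

text \<open>Substitution by the increasing map \<open>exp\<close> on \<open>[-n, n]\<close>,
  exhaustion of the two domains by continuity from below of the density measures, and a final
  reflection of \<open>x\<close>.\<close>

lemma nn_integral_exp_neg_substitution:
  fixes f :: "real \<Rightarrow> real"
  assumes [measurable]: "f \<in> borel_measurable borel"
  shows "(\<integral>\<^sup>+x. ennreal (f (exp (-x)) * exp (-x)) \<partial>lborel)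
    = (\<integral>\<^sup>+w. ennreal (f w) * indicator {0<..} w \<partial>lborel)"
proof -
  let ?M = "density lborel (\<lambda>w. ennreal (f w))"
  let ?N = "density lborel (\<lambda>x. ennreal (f (exp x) * exp x))"
  have eq: "emeasure ?M {exp (- real n)..exp (real n)} = emeasure ?N {- real n..real n}" for n
  proof -
    have "(\<integral>\<^sup>+w. ennreal (f w * indicator {exp (- real n)..exp (real n)} w) \<partial>lborel)
        = (\<integral>\<^sup>+x. ennreal (f (exp x) * exp x * indicator {- real n..real n} x) \<partial>lborel)"
    proof (rule nn_integral_substitution)
      show "set_borel_measurable borel {exp (- real n)..exp (real n)} f"
        unfolding set_borel_measurable_def by measurable
    qed (auto intro!: derivative_eq_intros continuous_intros)
    moreover have "ennreal (u * indicator S v) = ennreal u * indicator S v" for u v :: real and S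
      by (simp add: indicator_def)
    ultimately show ?thesis
      by (simp add: emeasure_density)
  qed
  have lim1: "(\<lambda>n. emeasure ?M {exp (- real n)..exp (real n)})
      \<longlonglongrightarrow> emeasure ?M (\<Union>n. {exp (- real n)..exp (real n)})"
    by (rule Lim_emeasure_incseq) (auto simp: incseq_def)
  have U1: "(\<Union>n. {exp (- real n)..exp (real n)}) = {0<..}"
  proof (intro equalityI subsetI)
    fix w :: real assume w: "w \<in> {0<..}"
    obtain n where "\<bar>ln w\<bar> \<le> real n" using real_arch_simple by blast
    then have "exp (- real n) \<le> exp (ln w)" "exp (ln w) \<le> exp (real n)" by auto
    moreover have "exp (ln w) = w" using w by simp
    ultimately have "exp (- real n) \<le> w" "w \<le> exp (real n)" by simp_all
    then show "w \<in> (\<Union>n. {exp (- real n)..exp (real n)})" by auto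
  qed (auto intro: less_le_trans[OF exp_gt_zero])
  have lim2: "(\<lambda>n. emeasure ?N {- real n..real n}) \<longlonglongrightarrow> emeasure ?N (\<Union>n. {- real n..real n})"
    by (rule Lim_emeasure_incseq) (auto simp: incseq_def)
  have U2: "(\<Union>n. {- real n..real n}) = UNIV"
  proof -
    have "x \<in> (\<Union>n. {- real n..real n})" for x
    proof -
      obtain n where "\<bar>x\<bar> \<le> real n" using real_arch_simple by blast
      then have "x \<in> {- real n..real n}" by auto
      then show ?thesis by blast
    qed
    then show ?thesis by blast
  qed
  have "emeasure ?M {0<..} = emeasure ?N UNIV"
    using LIMSEQ_unique[OF lim1[unfolded eq U1] lim2[unfolded U2]] .
  then have "(\<integral>\<^sup>+w. ennreal (f w) * indicator {0<..} w \<partial>lborel)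
      = (\<integral>\<^sup>+x. ennreal (f (exp x) * exp x) \<partial>lborel)"
    by (simp add: emeasure_density)
  also have "\<dots> = (\<integral>\<^sup>+x. ennreal (f (exp (-x)) * exp (-x)) \<partial>lborel)"
    by (subst nn_integral_real_affine[where c = "-1" and t = 0]) auto
  finally show ?thesis by simp
qed

lemma S3_S2_measurable:
  assumes [measurable]: "h \<in> borel_measurable borel"
  shows "S3 (S2 h) \<in> borel_measurable borel"
  unfolding S3_def S2_def by measurable

text \<open>The factor \<open>sqrt x\<close> of \<open>S2\<close>, squared and evaluated at
  \<open>exp (- x)\<close>, is exactly the Jacobian of the substitution.\<close>

lemma nn_integral_S3_S2:
  assumes [measurable]: "h \<in> borel_measurable borel" and h0: "\<And>w. w \<le> 0 \<Longrightarrow> h w = 0"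
  shows "(\<integral>\<^sup>+x. ennreal ((cmod (S3 (S2 h) x))\<^sup>2) \<partial>lborel) = (\<integral>\<^sup>+w. ennreal ((cmod (h w))\<^sup>2) \<partial>lborel)"
proof -
  have "(cmod (S3 (S2 h) x))\<^sup>2 = (cmod (h (exp (-x))))\<^sup>2 * exp (-x)" for x
    by (simp add: S3_def S2_def norm_mult power_mult_distrib)
  then have "(\<integral>\<^sup>+x. ennreal ((cmod (S3 (S2 h) x))\<^sup>2) \<partial>lborel)
      = (\<integral>\<^sup>+w. ennreal ((cmod (h w))\<^sup>2) * indicator {0<..} w \<partial>lborel)"
    by (simp only:) (rule nn_integral_exp_neg_substitution, measurable)
  also have "\<dots> = (\<integral>\<^sup>+w. ennreal ((cmod (h w))\<^sup>2) \<partial>lborel)"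
    using h0 by (intro nn_integral_cong) (auto simp: indicator_def)
  finally show ?thesis .
qed

lemma S3_S2_L2:
  assumes "h \<in> L2" "\<And>w. w \<le> 0 \<Longrightarrow> h w = 0"
  shows "S3 (S2 h) \<in> L2" "l2_norm (S3 (S2 h)) = l2_norm h"
proof -
  note [measurable] = L2_measurable[OF assms(1)]
  have *: "(\<integral>\<^sup>+x. ennreal ((cmod (S3 (S2 h) x))\<^sup>2) \<partial>lborel) = ennreal ((l2_norm h)\<^sup>2)"
    using nn_integral_S3_S2[OF _ assms(2)] nn_integral_L2[OF assms(1)] by simp
  show "S3 (S2 h) \<in> L2"
    by (rule L2_nn_integralI(1)[OF S3_S2_measurable *]) auto
  have "(l2_norm (S3 (S2 h)))\<^sup>2 = (l2_norm h)\<^sup>2"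
    by (rule L2_nn_integralI(2)[OF S3_S2_measurable *]) auto
  then show "l2_norm (S3 (S2 h)) = l2_norm h"
    by (simp add: power2_eq_iff_nonneg)
qed

lemma S3_S2_add: "S3 (S2 (\<lambda>x. g x + c * h x)) = (\<lambda>x. S3 (S2 g) x + c * S3 (S2 h) x)"
  by (simp add: S3_def S2_def fun_eq_iff algebra_simps)

lemma l2_inner_S3_S2:
  assumes "g \<in> L2" "\<And>w. w \<le> 0 \<Longrightarrow> g w = 0" "h \<in> L2" "\<And>w. w \<le> 0 \<Longrightarrow> h w = 0"
  shows "l2_inner (S3 (S2 g)) (S3 (S2 h)) = l2_inner g h"
proof (rule l2_inner_polarization)
  fix c
  show "l2_norm (\<lambda>x. S3 (S2 g) x + c * S3 (S2 h) x) = l2_norm (\<lambda>x. g x + c * h x)"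
    unfolding S3_S2_add[symmetric] using assms by (intro S3_S2_L2(2)) auto
qed (use assms S3_S2_L2 in auto)

lemma S3_S2_surj:
  assumes g: "g \<in> L2"
  obtains h where "h \<in> L2" "\<And>w. w \<le> 0 \<Longrightarrow> h w = 0" "S3 (S2 h) = g"
proof -
  note [measurable] = L2_measurable[OF g]
  \<comment> \<open>Solves \<open>g x = sqrt w * h w\<close> at \<open>w = exp (- x)\<close>; the
    resulting equation \<open>S3 (S2 h) = g\<close> holds at every point.\<close>
  define h where "h w = (if w > 0 then g (- ln w) / of_real (sqrt w) else 0)" for w
  have [measurable]: "h \<in> borel_measurable borel" unfolding h_def by measurable
  have h0: "h w = 0" if "w \<le> 0" for w using that by (simp add: h_def)
  have eq: "S3 (S2 h) = g"
    by (simp add: S3_def S2_def h_def fun_eq_iff)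
  have "(\<integral>\<^sup>+w. ennreal ((cmod (h w))\<^sup>2) \<partial>lborel) = ennreal ((l2_norm g)\<^sup>2)"
    using nn_integral_S3_S2[of h, OF _ h0] nn_integral_L2[OF g] by (simp add: eq)
  then have "h \<in> L2"
    by (intro L2_nn_integralI(1)[of h "(l2_norm g)\<^sup>2"]) auto
  then show thesis using h0 eq by (rule that)
qed

lemma is_fourier_AE_cong:
  assumes f: "is_fourier f g" and h: "h \<in> L2" and eq: "AE x in lborel. g x = h x"
  shows "is_fourier f h"
proof -
  note L2 = is_fourier_L2[OF f]
  note [measurable] = L2_measurable[OF L2(2)] L2_measurable[OF h] L2_measurable[OF fourier_trunc_L2[OF L2(1)]]
  have "l2_norm (\<lambda>w. fourier_trunc f N w - g w) = l2_norm (\<lambda>w. fourier_trunc f N w - h w)" for N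
    by (rule l2_norm_AE_cong) (use eq in auto)
  then show ?thesis
    using is_fourier_tendsto[OF f] by (simp add: is_fourier_iff[OF L2(1) h])
qed

section \<open>Unitarity of \<open>T1\<close>\<close>

lemma S1_L2:
  assumes "f \<in> L2"
  shows "S1 f \<in> L2"
proof -
  have "S1 f = (\<lambda>x. indicator {0<..} x * fourier f x)"
    by (auto simp: S1_def indicator_def)
  then show ?thesis
    using is_fourier_L2(2)[OF is_fourier_fourier[OF assms]] by auto
qed

lemma S1_nonpos: "w \<le> 0 \<Longrightarrow> S1 f w = 0"
  by (simp add: S1_def)

lemma T1_eq: "T1 f = S3 (S2 (S1 f))"
  by (simp add: T1_def)

lemma hardy_L2: "f \<in> hardy \<Longrightarrow> f \<in> L2"
  by (simp add: hardy_def)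

text \<open>On \<open>hardy\<close> the restriction to the positive half-line changes the transform
  only on a null set, so \<open>S1 f\<close> is itself a Fourier transform of \<open>f\<close> and
  inherits all its properties.\<close>

lemma is_fourier_S1:
  assumes f: "f \<in> hardy"
  shows "is_fourier f (S1 f)"
proof (rule is_fourier_AE_cong[OF is_fourier_fourier S1_L2])
  have "AE w in lborel. w < 0 \<longrightarrow> fourier f w = 0" using f by (simp add: hardy_def)
  moreover have "AE w in lborel. w \<noteq> (0 :: real)" by (rule AE_lborel_singleton)
  ultimately show "AE w in lborel. fourier f w = S1 f w"
    by eventually_elim (auto simp: S1_def)
qed (use f hardy_L2 in auto)

lemma T1_L2: "f \<in> hardy \<Longrightarrow> T1 f \<in> L2"
  unfolding T1_eq by (intro S3_S2_L2 S1_L2 S1_nonpos hardy_L2)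

lemma l2_inner_T1:
  assumes "f \<in> hardy" "g \<in> hardy"
  shows "l2_inner (T1 f) (T1 g) = l2_inner f g"
proof -
  have "l2_inner (T1 f) (T1 g) = l2_inner (S1 f) (S1 g)"
    unfolding T1_eq by (intro l2_inner_S3_S2 S1_L2 S1_nonpos hardy_L2 assms)
  also have "\<dots> = l2_inner f g"
    by (intro l2_inner_is_fourier is_fourier_S1 assms)
  finally show ?thesis .
qed

lemma l2_norm_T1: "f \<in> hardy \<Longrightarrow> l2_norm (T1 f) = l2_norm f"
  using l2_inner_T1[of f f] unfolding l2_inner_self of_real_eq_iff
  by (simp add: power2_eq_iff_nonneg)

text \<open>Surjectivity of \<open>S3 \<circ> S2\<close> and of the Fourier transform provide a
  witness, which justifies the choice by \<open>SOME\<close>.\<close>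

lemma T1_inv:
  assumes g: "g \<in> L2"
  shows "T1_inv g \<in> hardy \<and> (AE x in lborel. T1 (T1_inv g) x = g x)"
  unfolding T1_inv_def
proof (rule someI_ex[where P = "\<lambda>f. f \<in> hardy \<and> (AE x in lborel. T1 f x = g x)"])
  obtain h where h: "h \<in> L2" "\<And>w. w \<le> 0 \<Longrightarrow> h w = 0" "S3 (S2 h) = g"
    using S3_S2_surj[OF g] by blast
  obtain f where f: "is_fourier f h"
    using is_fourier_surj[OF h(1)] .
  have fL2: "f \<in> L2" using is_fourier_L2[OF f] by auto
  have eq: "AE w in lborel. fourier f w = h w"
    by (rule is_fourier_unique[OF is_fourier_fourier[OF fL2] f])
  then have "AE w in lborel. w < 0 \<longrightarrow> fourier f w = 0"
    by eventually_elim (simp add: h(2))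
  then have "f \<in> hardy" using fL2 by (simp add: hardy_def)
  moreover have "AE x in lborel. T1 f x = g x"
  proof -
    \<comment> \<open>\<open>S1 f\<close> and \<open>h\<close> agree only almost everywhere. That
      \<open>S3\<close> and \<open>S2\<close> respect this is read off from their isometry, applied
      to the difference of norm 0.\<close>
    define d where "d w = S1 f w + (-1) * h w" for w
    have dL2: "d \<in> L2" unfolding d_def using S1_L2[OF fL2] h(1) by (intro L2_add L2_cmult)
    have d0: "d w = 0" if "w \<le> 0" for w using that by (simp add: d_def h(2) S1_nonpos)
    have "AE w in lborel. d w = 0"
      using eq by eventually_elim (auto simp: d_def S1_def h(2))
    then have "l2_norm (S3 (S2 d)) = 0"
      using S3_S2_L2(2)[OF dL2 d0] l2_norm_eq_0_iff[OF dL2] by simp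
    then have "AE x in lborel. S3 (S2 d) x = 0"
      using l2_norm_eq_0_iff[OF S3_S2_L2(1)[OF dL2 d0]] by simp
    then show ?thesis
      unfolding d_def[abs_def] S3_S2_add h(3) T1_eq by simp
  qed
  ultimately show "\<exists>f. f \<in> hardy \<and> (AE x in lborel. T1 f x = g x)" by blast
qed

section \<open>Translations and the representation \<open>eta\<close>\<close>

lemma L2_shift:
  assumes "f \<in> L2"
  shows "(\<lambda>x. f (c + x)) \<in> L2" "l2_norm (\<lambda>x. f (c + x)) = l2_norm f"
proof -
  note [measurable] = L2_measurable[OF assms]
  show "(\<lambda>x. f (c + x)) \<in> L2"
    using lborel_integrable_real_affine[OF L2_integrable[OF assms], of 1 c]
    by (intro L2I) auto
  show "l2_norm (\<lambda>x. f (c + x)) = l2_norm f"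
    unfolding l2_norm_def using lborel_integral_real_affine[of 1 "\<lambda>x. (cmod (f x))\<^sup>2" c] by simp
qed

text \<open>Translation invariance of null sets, read off from that of the norm.\<close>

lemma AE_shift:
  fixes f :: "real \<Rightarrow> complex"
  assumes "f \<in> L2" "AE x in lborel. f x = 0"
  shows "AE x in lborel. f (c + x) = 0"
proof -
  have "l2_norm (\<lambda>x. f (c + x)) = 0"
    using L2_shift(2)[OF assms(1)] l2_norm_eq_0_iff[OF assms(1)] assms(2) by simp
  then show ?thesis
    by (simp add: l2_norm_eq_0_iff[OF L2_shift(1)[OF assms(1)]])
qed

lemma cmod_eta: "cmod (eta A B (c, v) f x) = cmod (f (c + x))"
  by (cases v) (simp add: norm_mult)

lemma eta_L2:
  assumes "f \<in> L2"
  shows "eta A B (c, v) f \<in> L2"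
proof (rule L2_dominated[OF _ L2_shift(1)[OF assms, of c], of _ 1])
  note [measurable] = L2_measurable[OF assms]
  show "eta A B (c, v) f \<in> borel_measurable borel"
    by (cases v) (simp flip: cis_conv_exp)
qed (simp add: cmod_eta)

lemma eta_AE_cong:
  assumes "f \<in> L2" "g \<in> L2" "AE x in lborel. f x = g x"
  shows "AE x in lborel. eta A B (c, v) f x = eta A B (c, v) g x"
proof -
  have "AE x in lborel. f (c + x) - g (c + x) = 0"
    using AE_shift[OF L2_diff[OF assms(1,2)], of c] assms(3) by simp
  then show ?thesis
    by (cases v) (auto elim!: eventually_mono)
qed

text \<open>Two choices are nested in \<open>psi_hat\<close>: \<open>T1 (T1_inv \<psi>)\<close> is
  \<open>\<psi>\<close> up to a null set, \<open>eta\<close> keeps that, and the outer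
  \<open>T1_inv\<close> is undone by \<open>T1\<close> up to another null set.\<close>

lemma psi_hat_hardy:
  assumes "\<psi> \<in> L2"
  shows "psi_hat A B q0 p0 \<psi> (n, m) \<in> hardy"
    and "AE x in lborel. T1 (psi_hat A B q0 p0 \<psi> (n, m)) x
      = eta A B (of_int n * q0, (of_int n * q0 * of_int m * p0) / 2, of_int m * p0) \<psi> x"
proof -
  let ?h = "(of_int n * q0, (of_int n * q0 * of_int m * p0) / 2, of_int m * p0)"
  note inv = T1_inv[OF assms]
  have TL2: "T1 (T1_inv \<psi>) \<in> L2" using inv T1_L2 by blast
  have eq: "psi_hat A B q0 p0 \<psi> (n, m) = T1_inv (eta A B ?h (T1 (T1_inv \<psi>)))"
    by (simp add: psi_hat_def eta_hardy_def)
  note inv' = T1_inv[OF eta_L2[OF TL2], of A B "of_int n * q0" "snd ?h"]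
  show "psi_hat A B q0 p0 \<psi> (n, m) \<in> hardy"
    unfolding eq using inv' by simp
  have "AE x in lborel. T1 (psi_hat A B q0 p0 \<psi> (n, m)) x = eta A B ?h (T1 (T1_inv \<psi>)) x"
    unfolding eq using inv' by simp
  moreover have "AE x in lborel. eta A B ?h (T1 (T1_inv \<psi>)) x = eta A B ?h \<psi> x"
    by (rule eta_AE_cong[OF TL2 assms]) (use inv in simp)
  ultimately show "AE x in lborel. T1 (psi_hat A B q0 p0 \<psi> (n, m)) x = eta A B ?h \<psi> x"
    by eventually_elim simp
qed

section \<open>Summation of the frame coefficients\<close>

lemma has_sum_l2_inner_eta:
  assumes "A \<noteq> 0" "L > 0" "p0 = pi / (A * L)"
    and F: "F \<in> L2" and \<psi>: "\<psi> \<in> L2" and bound: "\<And>x. cmod (\<psi> x) \<le> C"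
    and supp: "AE x in lborel. x \<notin> {-L..L} \<longrightarrow> \<psi> x = 0"
  shows "((\<lambda>m::int. (cmod (l2_inner F (eta A B (c, c * of_int m * p0 / 2, of_int m * p0) \<psi>)))\<^sup>2)
    has_sum 2 * L * (l2_norm (\<lambda>x. F x * cnj (\<psi> (c + x))))\<^sup>2) UNIV"
proof -
  note [measurable] = L2_measurable[OF F] L2_measurable[OF \<psi>]
  let ?G = "\<lambda>x. F x * cnj (\<psi> (c + x))"
  have G: "?G \<in> L2"
  proof (rule L2_dominated[OF _ F, of _ C])
    show "cmod (?G x) \<le> C * cmod (F x)" for x
      using mult_right_mono[OF bound[of "c + x"] norm_ge_zero[of "F x"]]
      by (simp add: norm_mult mult.commute)
  qed measurable
  \<comment> \<open>The support condition is restated as the vanishing of an \<open>L2\<close>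
    function, the form in which \<open>AE_shift\<close> can translate it. The shifted support is
    centred at \<open>- c\<close>.\<close>
  have "(\<lambda>x. indicator (- {-L..L}) x * \<psi> x) \<in> L2"
    using \<psi> by (intro L2_indicator) auto
  moreover have "AE x in lborel. indicator (- {-L..L}) x * \<psi> x = 0"
    using supp by eventually_elim (auto simp: indicator_def)
  ultimately have "AE x in lborel. indicator (- {-L..L}) (c + x) * \<psi> (c + x) = 0"
    by (rule AE_shift)
  then have "AE x in lborel. x \<notin> {- c - L..- c + L} \<longrightarrow> ?G x = 0"
    by eventually_elim (auto simp: indicator_def)
  note Parseval = Parseval_interval[OF G \<open>L > 0\<close> this]
  have "cmod (l2_inner F (eta A B (c, c * of_int m * p0 / 2, of_int m * p0) \<psi>))
      = cmod (\<integral>x. ?G x * cis (- (of_int m * (pi / L) * x)) \<partial>lborel)" for m :: int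
  proof -
    \<comment> \<open>Collects the phases independent of \<open>x\<close>, including everything
      contributed by \<open>B\<close>; only the modulus of the coefficient matters, so
      \<open>u\<close> drops out.\<close>
    define u where "u = cis (A * (c * of_int m * p0 / 2) + B * (of_int m * p0))"
    have "eta A B (c, c * of_int m * p0 / 2, of_int m * p0) \<psi> x
        = u * cis (of_int m * (pi / L) * x) * \<psi> (c + x)" for x
    proof -
      have "A * (c * of_int m * p0 / 2 + x * (of_int m * p0)) + B * (of_int m * p0)
          = (A * (c * of_int m * p0 / 2) + B * (of_int m * p0)) + of_int m * (pi / L) * x"
        using assms(1-3) by (simp add: field_simps)
      then show ?thesis
        by (simp only: eta.simps u_def cis_mult flip: cis_conv_exp)
    qed
    then have "l2_inner F (eta A B (c, c * of_int m * p0 / 2, of_int m * p0) \<psi>)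
        = (\<integral>x. u * cnj (?G x * cis (- (of_int m * (pi / L) * x))) \<partial>lborel)"
      unfolding l2_inner_def
      by (intro Bochner_Integration.integral_cong refl) (simp add: cis_cnj)
    also have "\<dots> = u * cnj (\<integral>x. ?G x * cis (- (of_int m * (pi / L) * x)) \<partial>lborel)"
      by (simp only: integral_mult_right_zero Bochner_Integration.integral_cnj)
    finally show ?thesis by (simp add: norm_mult u_def)
  qed
  then show ?thesis using Parseval by simp
qed

lemma has_sum_int_ennrealI:
  fixes a :: "int \<Rightarrow> real"
  assumes "\<And>n. 0 \<le> a n" "0 \<le> s" "(\<Sum>k. ennreal (a (int_decode k))) = ennreal s"
  shows "(a has_sum s) UNIV"
proof -
  have summ: "summable (\<lambda>k. a (int_decode k))"
    using assms by (intro summable_suminf_not_top) auto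
  have "ennreal (\<Sum>k. a (int_decode k)) = ennreal s"
    using suminf_ennreal2[OF _ summ] assms(1,3) by simp
  then have "(\<Sum>k. a (int_decode k)) = s"
    using assms(1,2) suminf_nonneg[OF summ] by simp
  then have "((\<lambda>k. a (int_decode k)) has_sum s) UNIV"
    using summ assms(1) by (intro sums_nonneg_imp_has_sum) (auto simp: sums_iff)
  then show ?thesis
    by (simp add: has_sum_reindex_bij_betw[OF bij_int_decode])
qed

text \<open>By Tonelli's theorem the sum over \<open>n\<close> moves inside the integral, where the
  hypothesis gives \<open>chi * (cmod (F x))\<^sup>2\<close> at each \<open>x\<close>.\<close>

lemma has_sum_l2_norm_translates:
  assumes F: "F \<in> L2" and \<psi>: "\<psi> \<in> borel_measurable borel" and chi: "0 \<le> chi"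
    and sum: "\<And>x::real. ((\<lambda>n::int. (cmod (\<psi> (x + of_int n * q0)))\<^sup>2) has_sum chi) UNIV"
    and L2: "\<And>n::int. (\<lambda>x. F x * cnj (\<psi> (of_int n * q0 + x))) \<in> L2"
  shows "((\<lambda>n::int. (l2_norm (\<lambda>x. F x * cnj (\<psi> (of_int n * q0 + x))))\<^sup>2)
    has_sum chi * (l2_norm F)\<^sup>2) UNIV"
proof (rule has_sum_int_ennrealI)
  note [measurable] = L2_measurable[OF F] \<psi>
  have "(\<Sum>k. ennreal ((l2_norm (\<lambda>x. F x * cnj (\<psi> (of_int (int_decode k) * q0 + x))))\<^sup>2))
      = (\<Sum>k. \<integral>\<^sup>+x. ennreal ((cmod (F x * cnj (\<psi> (of_int (int_decode k) * q0 + x))))\<^sup>2) \<partial>lborel)"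
    by (simp only: nn_integral_L2[OF L2])
  also have "\<dots> = (\<integral>\<^sup>+x. ennreal ((cmod (F x))\<^sup>2 * chi) \<partial>lborel)"
  proof (rule nn_integral_has_sum_int[symmetric])
    show "((\<lambda>n. (cmod (F x * cnj (\<psi> (of_int n * q0 + x))))\<^sup>2) has_sum (cmod (F x))\<^sup>2 * chi) UNIV" for x
      using has_sum_cmult_right[OF sum[of x], of "(cmod (F x))\<^sup>2"]
      by (simp add: norm_mult power_mult_distrib add.commute)
  qed auto
  \<comment> \<open>Absorbing \<open>chi\<close> into the function as \<open>sqrt chi\<close> lets
    \<open>nn_integral_L2\<close> evaluate the integral.\<close>
  also have "\<dots> = (\<integral>\<^sup>+x. ennreal ((cmod (of_real (sqrt chi) * F x))\<^sup>2) \<partial>lborel)"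
    using chi by (simp add: norm_mult power_mult_distrib mult.commute)
  also have "\<dots> = ennreal (chi * (l2_norm F)\<^sup>2)"
    unfolding nn_integral_L2[OF L2_cmult[OF F]] using chi
    by (simp add: l2_norm_cmult power_mult_distrib)
  finally show "(\<Sum>k. ennreal ((l2_norm (\<lambda>x. F x * cnj (\<psi> (of_int (int_decode k) * q0 + x))))\<^sup>2))
      = ennreal (chi * (l2_norm F)\<^sup>2)" .
qed (use chi in auto)

theorem propositionV1:
  fixes A B L p0 q0 chi :: real and \<psi> :: "real \<Rightarrow> complex"
  assumes "A \<noteq> 0" and "L > 0"
    and "\<psi> \<in> L2" and "\<not> (AE x in lborel. \<psi> x = 0)"
    and "AE x in lborel. x \<notin> {-L..L} \<longrightarrow> \<psi> x = 0"
    and "p0 = pi / (A * L)"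
    and "\<bar>q0 * p0\<bar> < 2 * pi"
    and "chi > 0"
    and "\<And>x::real. ((\<lambda>n::int. (cmod (\<psi> (x + of_int n * q0)))\<^sup>2) has_sum chi) UNIV"
  shows "tight_frame hardy UNIV (psi_hat A B q0 p0 \<psi>) (2 * L * chi)"
  unfolding tight_frame_def
proof (intro conjI ballI)
  note [measurable] = L2_measurable[OF assms(3)]
  \<comment> \<open>The term \<open>n = 0\<close> is at most the full sum of nonnegative
    terms.\<close>
  have bound: "cmod (\<psi> x) \<le> sqrt chi" for x
  proof (rule real_le_rsqrt)
    show "(cmod (\<psi> x))\<^sup>2 \<le> chi"
      using finite_sum_le_has_sum[OF assms(9)[of x], of "{0}"] by simp
  qed
  show "countable (UNIV :: (int \<times> int) set)" "0 < 2 * L * chi"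
    using assms by auto
  show "psi_hat A B q0 p0 \<psi> k \<in> hardy" for k
    using psi_hat_hardy(1)[OF assms(3)] by (cases k) simp
  fix f assume f: "f \<in> hardy"
  define F where "F = T1 f"
  have F: "F \<in> L2" unfolding F_def by (rule T1_L2[OF f])
  note [measurable] = L2_measurable[OF F]
  let ?h = "\<lambda>n m. (of_int n * q0, of_int n * q0 * of_int m * p0 / 2, of_int m * p0)"
  let ?c = "\<lambda>(n, m). (cmod (l2_inner f (psi_hat A B q0 p0 \<psi> (n, m))))\<^sup>2"
  let ?G = "\<lambda>n. 2 * L * (l2_norm (\<lambda>x. F x * cnj (\<psi> (of_int n * q0 + x))))\<^sup>2"
  have coeff: "l2_inner f (psi_hat A B q0 p0 \<psi> (n, m)) = l2_inner F (eta A B (?h n m) \<psi>)" for n m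
  proof -
    note ph = psi_hat_hardy[OF assms(3), of A B q0 p0 n m]
    have "l2_inner f (psi_hat A B q0 p0 \<psi> (n, m)) = l2_inner F (T1 (psi_hat A B q0 p0 \<psi> (n, m)))"
      unfolding F_def by (rule l2_inner_T1[OF f ph(1), symmetric])
    also have "\<dots> = l2_inner F (eta A B (?h n m) \<psi>)"
      using ph(2) L2_measurable[OF T1_L2[OF ph(1)]] L2_measurable[OF eta_L2[OF assms(3)]]
      by (intro l2_inner_AE_cong) auto
    finally show ?thesis .
  qed
  have inner: "((\<lambda>m. ?c (n, m)) has_sum ?G n) UNIV" for n
    using has_sum_l2_inner_eta[OF assms(1,2,6) F assms(3) bound assms(5), of B "of_int n * q0"]
    by (simp only: coeff prod.case)
  have GL2: "(\<lambda>x. F x * cnj (\<psi> (of_int n * q0 + x))) \<in> L2" for n :: int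
  proof (rule L2_dominated[OF _ F, of _ "sqrt chi"])
    show "cmod (F x * cnj (\<psi> (of_int n * q0 + x))) \<le> sqrt chi * cmod (F x)" for x
      using mult_right_mono[OF bound[of "of_int n * q0 + x"] norm_ge_zero[of "F x"]]
      by (simp add: norm_mult mult.commute)
  qed measurable
  have outer: "(?G has_sum 2 * L * (chi * (l2_norm F)\<^sup>2)) UNIV"
    using assms(8,9) by (intro has_sum_cmult_right has_sum_l2_norm_translates F GL2) auto
  have "(?c has_sum 2 * L * (chi * (l2_norm F)\<^sup>2)) (UNIV \<times> UNIV)"
  proof (rule has_sum_SigmaI[OF inner outer])
    \<comment> \<open>For nonnegative terms, convergence of the iterated sum already gives
      summability over the pairs.\<close>
    show "?c summable_on UNIV \<times> UNIV"
      by (rule summable_on_SigmaI[OF inner has_sum_imp_summable[OF outer]]) auto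
  qed
  moreover have "?c = (\<lambda>k. (cmod (l2_inner f (psi_hat A B q0 p0 \<psi> k)))\<^sup>2)"
    by auto
  ultimately show "((\<lambda>k. (cmod (l2_inner f (psi_hat A B q0 p0 \<psi> k)))\<^sup>2)
      has_sum 2 * L * chi * (l2_norm f)\<^sup>2) UNIV"
    using l2_norm_T1[OF f] by (simp add: F_def mult.assoc)
qed

end
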